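(* Let $\mathbb{K}$ be a field. Every semi-commutative skew PBW extension $A=\sigma(\mathbb{K})\langle x_1,\dots,x_n\rangle$ of $\mathbb{K}$ is a homogeneous Koszul algebra.
   Context: Skew PBW extension. Let $\mathbb{K}$ be a field. A ring $A\supseteq\mathbb{K}$ is a skew PBW extension of $\mathbb{K}$ in the variables $x_1,\dots,x_n\in A$, written $A=\sigma(\mathbb{K})\langle x_1,\dots,x_n\rangle$, if: $A$ is a free left $\mathbb{K}$-module with basis the standard monomials $\{x_1^{\alpha_1}\cdots x_n^{\alpha_n}\mid \alpha\in\mathbb{N}^n\}$; for each $i$ and each $r\in\mathbb{K}\setminus\{0\}$ there is $c_{i,r}\in\mathbb{K}\setminus\{0\}$ with $x_ir-c_{i,r}x_i\in\mathbb{K}$; and for all $1\le i,j\le n$ there is $c_{i,j}\in\mathbb{K}\setminus\{0\}$ with $x_jx_i-c_{i,j}x_ix_j\in\mathbb{K}+\mathbb{K}x_1+\cdots+\mathbb{K}x_n$. Semi-commutative. $A$ is constant if $x_ir=rx_i$ for all $i$ and all $r\in\mathbb{K}$. $A$ is quasi-commutative if for each $i$ and each $r\in\mathbb{K}\setminus\{0\}$ there is $c_{i,r}\in\mathbb{K}\setminus\{0\}$ with $x_ir=c_{i,r}x_i$, and for all $1\le i,j\le n$ there is $c_{i,j}\in\mathbb{K}\setminus\{0\}$ with $x_jx_i=c_{i,j}x_ix_j$. $A$ is semi-commutative if it is quasi-commutative and constant. Homogeneous Koszul. Let $L=\mathbb{K}\langle x_1,\dots,x_n\rangle$ be the free associative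 algebra. An algebra $B=L/I$ is homogeneous pre-Koszul if the two-sided ideal $I$ is generated by elements of the form $\sum_{j,k}c_{j,k}x_jx_k$, $c_{j,k}\in\mathbb{K}$; then $B$ is graded with $\deg x_i=1$, and $\mathbb{K}=B/B_{\ge1}$ is a graded $B$-module concentrated in degree $0$. A homogeneous pre-Koszul algebra $B$ is homogeneous Koszul if the following equivalent conditions hold: (i) $\mathrm{Ext}^{i,j}_B(\mathbb{K},\mathbb{K}):=\mathrm{Ext}^i_B(\mathbb{K},\mathbb{K}(-j))=0$ for all $i\ne j$, where Ext is computed in the category of graded $B$-modules with degree-preserving maps and $M(-j)_l=M_{l-j}$; (ii) the Yoneda algebra $\bigoplus_{i,j}\mathrm{Ext}^{i,j}_B(\mathbb{K},\mathbb{K})$ is generated by $\mathrm{Ext}^{1,1}_B(\mathbb{K},\mathbb{K})$; (iii) $\mathbb{K}$ admits a resolution $\cdots\to P_2\to P_1\to P_0\to\mathbb{K}\to0$ by graded free $B$-modules with $P_i$ generated in degree $i$. The skew PBW extension $A$ is presented as the quotient of $L$ by the kernel of $L\to A$, $x_i\mapsto x_i$. *)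

theory Defs
  imports Complex_Main "HOL-Library.Poly_Mapping"
begin

section \<open>Bases and direct sums\<close>

text \<open>
  A family \<open>b\<close> indexed by \<open>E\<close> (not merely the set of its values) is a basis of the left module
  with underlying set \<open>M\<close>.
\<close>

definition is_basis ::
  "('s::zero \<Rightarrow> 'm \<Rightarrow> 'm::comm_monoid_add) \<Rightarrow> 'm set \<Rightarrow> 'i set \<Rightarrow> ('i \<Rightarrow> 'm) \<Rightarrow> bool" where
  "is_basis sm M E b \<longleftrightarrow> b ` E \<subseteq> M \<and>
     (\<forall>m\<in>M. \<exists>!c :: 'i \<Rightarrow>\<^sub>0 's. Poly_Mapping.keys c \<subseteq> E \<and>
        m = (\<Sum>i\<in>Poly_Mapping.keys c. sm (Poly_Mapping.lookup c i) (b i)))"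

definition add_subgroup :: "'m::ab_group_add set \<Rightarrow> bool" where
  "add_subgroup M \<longleftrightarrow> 0 \<in> M \<and> (\<forall>u\<in>M. \<forall>v\<in>M. u - v \<in> M)"

definition is_direct_sum :: "'m::ab_group_add set \<Rightarrow> (nat \<Rightarrow> 'm set) \<Rightarrow> bool" where
  "is_direct_sum M G \<longleftrightarrow> (\<forall>d. add_subgroup (G d) \<and> G d \<subseteq> M) \<and>
     (\<forall>m\<in>M. \<exists>!c :: nat \<Rightarrow>\<^sub>0 'm. (\<forall>d. Poly_Mapping.lookup c d \<in> G d) \<and>
        m = (\<Sum>d\<in>Poly_Mapping.keys c. Poly_Mapping.lookup c d))"


section \<open>Skew PBW extensions of a field\<close>

text \<open>
  The inclusion of the field in the ring is represented by an injective unital ring homomorphism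
  \<open>\<iota>\<close>; its image need not be central. The variables are \<open>x 1, \<dots>, x n\<close>, and the values of \<open>x\<close> at
  other indices are irrelevant.
\<close>

definition ring_embedding :: "('k::ring_1 \<Rightarrow> 'a::ring_1) \<Rightarrow> bool" where
  "ring_embedding \<iota> \<longleftrightarrow> inj \<iota> \<and> \<iota> 1 = 1 \<and>
     (\<forall>r s. \<iota> (r + s) = \<iota> r + \<iota> s) \<and> (\<forall>r s. \<iota> (r * s) = \<iota> r * \<iota> s)"

definition exponents :: "nat \<Rightarrow> (nat \<Rightarrow>\<^sub>0 nat) set" where
  "exponents n = {\<alpha>. Poly_Mapping.keys \<alpha> \<subseteq> {1..n}}"

definition std_monomial :: "nat \<Rightarrow> (nat \<Rightarrow> 'a::monoid_mult) \<Rightarrow> (nat \<Rightarrow>\<^sub>0 nat) \<Rightarrow> 'a" where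
  "std_monomial n x \<alpha> = prod_list (map (\<lambda>i. x i ^ Poly_Mapping.lookup \<alpha> i) [1..<Suc n])"

definition skew_PBW_extension ::
  "('k::field \<Rightarrow> 'a::ring_1) \<Rightarrow> nat \<Rightarrow> (nat \<Rightarrow> 'a) \<Rightarrow> bool" where
  "skew_PBW_extension \<iota> n x \<longleftrightarrow>
     ring_embedding \<iota> \<and>
     is_basis (\<lambda>r a. \<iota> r * a) UNIV (exponents n) (std_monomial n x) \<and>
     (\<forall>i\<in>{1..n}. \<forall>r. r \<noteq> 0 \<longrightarrow> (\<exists>c. c \<noteq> 0 \<and> x i * \<iota> r - \<iota> c * x i \<in> range \<iota>)) \<and>
     (\<forall>i\<in>{1..n}. \<forall>j\<in>{1..n}. \<exists>c. c \<noteq> 0 \<and>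
        x j * x i - \<iota> c * x i * x j \<in> {\<iota> r + (\<Sum>l=1..n. \<iota> (s l) * x l) | r s. True})"

definition constant_ext :: "('k::field \<Rightarrow> 'a::ring_1) \<Rightarrow> nat \<Rightarrow> (nat \<Rightarrow> 'a) \<Rightarrow> bool" where
  "constant_ext \<iota> n x \<longleftrightarrow> (\<forall>i\<in>{1..n}. \<forall>r. x i * \<iota> r = \<iota> r * x i)"

definition quasi_commutative_ext ::
  "('k::field \<Rightarrow> 'a::ring_1) \<Rightarrow> nat \<Rightarrow> (nat \<Rightarrow> 'a) \<Rightarrow> bool" where
  "quasi_commutative_ext \<iota> n x \<longleftrightarrow>
     (\<forall>i\<in>{1..n}. \<forall>r. r \<noteq> 0 \<longrightarrow> (\<exists>c. c \<noteq> 0 \<and> x i * \<iota> r = \<iota> c * x i)) \<and>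
     (\<forall>i\<in>{1..n}. \<forall>j\<in>{1..n}. \<exists>c. c \<noteq> 0 \<and> x j * x i = \<iota> c * x i * x j)"

definition semi_commutative_ext ::
  "('k::field \<Rightarrow> 'a::ring_1) \<Rightarrow> nat \<Rightarrow> (nat \<Rightarrow> 'a) \<Rightarrow> bool" where
  "semi_commutative_ext \<iota> n x \<longleftrightarrow> quasi_commutative_ext \<iota> n x \<and> constant_ext \<iota> n x"


section \<open>The free associative algebra\<close>

text \<open>
  Words in the letters \<open>x\<^sub>i\<close> under concatenation, written additively so that the convolution
  product of finitely supported functions turns \<open>free_monoid \<Rightarrow>\<^sub>0 'k\<close> into the free algebra.
\<close>

datatype free_monoid = Word (letters: "nat list")

instantiation free_monoid :: monoid_add
begin

definition zero_free_monoid :: free_monoid where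
  "0 = Word []"

definition plus_free_monoid :: "free_monoid \<Rightarrow> free_monoid \<Rightarrow> free_monoid" where
  "u + v = Word (letters u @ letters v)"

instance
  by standard (simp_all add: zero_free_monoid_def plus_free_monoid_def)

end

definition free_algebra :: "nat \<Rightarrow> (free_monoid \<Rightarrow>\<^sub>0 'k::field) set" where
  "free_algebra n = {f. \<forall>w\<in>Poly_Mapping.keys f. set (letters w) \<subseteq> {1..n}}"

definition free_component :: "nat \<Rightarrow> nat \<Rightarrow> (free_monoid \<Rightarrow>\<^sub>0 'k::field) set" where
  "free_component n d =
     {f \<in> free_algebra n. \<forall>w\<in>Poly_Mapping.keys f. length (letters w) = d}"

definition two_sided_ideal :: "nat \<Rightarrow> (free_monoid \<Rightarrow>\<^sub>0 'k::field) set \<Rightarrow> bool" where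
  "two_sided_ideal n I \<longleftrightarrow> I \<subseteq> free_algebra n \<and> add_subgroup I \<and>
     (\<forall>f\<in>free_algebra n. \<forall>g\<in>I. f * g \<in> I \<and> g * f \<in> I)"

definition generated_ideal ::
  "nat \<Rightarrow> (free_monoid \<Rightarrow>\<^sub>0 'k::field) set \<Rightarrow> (free_monoid \<Rightarrow>\<^sub>0 'k) set" where
  "generated_ideal n S = \<Inter>{I. two_sided_ideal n I \<and> S \<subseteq> I}"

definition quadratic_forms :: "nat \<Rightarrow> (free_monoid \<Rightarrow>\<^sub>0 'k::field) set" where
  "quadratic_forms n =
     {\<Sum>j=1..n. \<Sum>k=1..n. Poly_Mapping.single (Word [j, k]) (c j k) | c. True}"

definition free_eval ::
  "('k::field \<Rightarrow> 'a::ring_1) \<Rightarrow> (nat \<Rightarrow> 'a) \<Rightarrow> (free_monoid \<Rightarrow>\<^sub>0 'k) \<Rightarrow> 'a" where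
  "free_eval \<iota> x f =
     (\<Sum>w\<in>Poly_Mapping.keys f. \<iota> (Poly_Mapping.lookup f w) * prod_list (map x (letters w)))"


section \<open>Homogeneous pre-Koszul algebras\<close>

text \<open>
  An algebra \<open>B = L / I\<close> is given as an associative unital algebra together with the images
  \<open>x 1, \<dots>, x n\<close> of the free generators: the canonical map from \<open>L\<close> is onto and \<open>I\<close> is its
  kernel. Centrality of the scalars is what makes this map an algebra homomorphism.
\<close>

definition homogeneous_pre_Koszul ::
  "('k::field \<Rightarrow> 'a::ring_1) \<Rightarrow> nat \<Rightarrow> (nat \<Rightarrow> 'a) \<Rightarrow> bool" where
  "homogeneous_pre_Koszul \<iota> n x \<longleftrightarrow>
     ring_embedding \<iota> \<and> (\<forall>r b. \<iota> r * b = b * \<iota> r) \<and>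
     free_eval \<iota> x ` free_algebra n = UNIV \<and>
     (\<exists>R. R \<subseteq> quadratic_forms n \<and>
        {f \<in> free_algebra n. free_eval \<iota> x f = 0} = generated_ideal n R)"

definition alg_component ::
  "('k::field \<Rightarrow> 'a::ring_1) \<Rightarrow> nat \<Rightarrow> (nat \<Rightarrow> 'a) \<Rightarrow> nat \<Rightarrow> 'a set" where
  "alg_component \<iota> n x d = free_eval \<iota> x ` free_component n d"

text \<open>The ideal \<open>B\<^bsub>\<ge>1\<^esub>\<close>, as the image of the elements of \<open>L\<close> without constant term.\<close>

definition irrelevant_ideal ::
  "('k::field \<Rightarrow> 'a::ring_1) \<Rightarrow> nat \<Rightarrow> (nat \<Rightarrow> 'a) \<Rightarrow> 'a set" where
  "irrelevant_ideal \<iota> n x =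
     free_eval \<iota> x ` {f \<in> free_algebra n. Poly_Mapping.lookup f (Word []) = 0}"

text \<open>The projection of \<open>B\<close> onto \<open>B / B\<^bsub>\<ge>1\<^esub> = \<K>\<close>.\<close>

definition residue_map ::
  "('k::field \<Rightarrow> 'a::ring_1) \<Rightarrow> nat \<Rightarrow> (nat \<Rightarrow> 'a) \<Rightarrow> 'a \<Rightarrow> 'k" where
  "residue_map \<iota> n x b = (THE r. b - \<iota> r \<in> irrelevant_ideal \<iota> n x)"


section \<open>Graded left modules and linear free resolutions\<close>

record ('a, 'm) graded_mod =
  mcarrier :: "'m set"
  msmult :: "'a \<Rightarrow> 'm \<Rightarrow> 'm"
  mcomponent :: "nat \<Rightarrow> 'm set"

text \<open>
  The underlying group is a subgroup of a type; \<open>G\<close> is the grading of the ring. Gradings by \<open>\<nat>\<close>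
  suffice because all modules occurring below vanish in negative degrees.
\<close>

definition is_graded_module ::
  "(nat \<Rightarrow> 'a::ring_1 set) \<Rightarrow> ('a, 'm::ab_group_add) graded_mod \<Rightarrow> bool" where
  "is_graded_module G M \<longleftrightarrow>
     add_subgroup (mcarrier M) \<and>
     (\<forall>a. \<forall>u\<in>mcarrier M. msmult M a u \<in> mcarrier M) \<and>
     (\<forall>a. \<forall>u\<in>mcarrier M. \<forall>v\<in>mcarrier M. msmult M a (u + v) = msmult M a u + msmult M a v) \<and>
     (\<forall>a b. \<forall>u\<in>mcarrier M. msmult M (a + b) u = msmult M a u + msmult M b u) \<and>
     (\<forall>a b. \<forall>u\<in>mcarrier M. msmult M (a * b) u = msmult M a (msmult M b u)) \<and>
     (\<forall>u\<in>mcarrier M. msmult M 1 u = u) \<and>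
     is_direct_sum (mcarrier M) (mcomponent M) \<and>
     (\<forall>i j. \<forall>a\<in>G i. \<forall>u\<in>mcomponent M j. msmult M a u \<in> mcomponent M (i + j))"

definition is_graded_hom ::
  "('m \<Rightarrow> 'p) \<Rightarrow> ('a, 'm::ab_group_add) graded_mod \<Rightarrow> ('a, 'p::ab_group_add) graded_mod \<Rightarrow> bool"
where
  "is_graded_hom h M N \<longleftrightarrow>
     h ` mcarrier M \<subseteq> mcarrier N \<and>
     (\<forall>u\<in>mcarrier M. \<forall>v\<in>mcarrier M. h (u + v) = h u + h v) \<and>
     (\<forall>a. \<forall>u\<in>mcarrier M. h (msmult M a u) = msmult N a (h u)) \<and>
     (\<forall>j. h ` mcomponent M j \<subseteq> mcomponent N j)"

text \<open>Free with a basis of homogeneous elements of degree \<open>i\<close>, i.e. a direct sum of copies of \<open>B(-i)\<close>.\<close>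

definition free_generated_in_degree ::
  "nat \<Rightarrow> ('a::ring_1, 'm::ab_group_add) graded_mod \<Rightarrow> bool" where
  "free_generated_in_degree i M \<longleftrightarrow>
     (\<exists>E. E \<subseteq> mcomponent M i \<and> is_basis (msmult M) (mcarrier M) E (\<lambda>e. e))"

definition residue_module ::
  "('k::field \<Rightarrow> 'a::ring_1) \<Rightarrow> nat \<Rightarrow> (nat \<Rightarrow> 'a) \<Rightarrow> ('a, 'k) graded_mod" where
  "residue_module \<iota> n x =
     \<lparr>mcarrier = UNIV,
      msmult = (\<lambda>b r. residue_map \<iota> n x b * r),
      mcomponent = (\<lambda>d. if d = 0 then UNIV else {0})\<rparr>"

text \<open>
  Here \<open>D i\<close> is the differential \<open>P\<^sub>i\<^sub>+\<^sub>1 \<rightarrow> P\<^sub>i\<close> and \<open>e\<close> the map \<open>P\<^sub>0 \<rightarrow> \<K>\<close>.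
\<close>

definition is_linear_free_resolution ::
  "(nat \<Rightarrow> 'a::ring_1 set) \<Rightarrow> ('a, 'k::ab_group_add) graded_mod \<Rightarrow>
   (nat \<Rightarrow> ('a, 'm::ab_group_add) graded_mod) \<Rightarrow> (nat \<Rightarrow> 'm \<Rightarrow> 'm) \<Rightarrow> ('m \<Rightarrow> 'k) \<Rightarrow> bool" where
  "is_linear_free_resolution G N P D e \<longleftrightarrow>
     (\<forall>i. is_graded_module G (P i) \<and> free_generated_in_degree i (P i)) \<and>
     is_graded_hom e (P 0) N \<and>
     (\<forall>i. is_graded_hom (D i) (P (Suc i)) (P i)) \<and>
     e ` mcarrier (P 0) = mcarrier N \<and>
     D 0 ` mcarrier (P 1) = {u \<in> mcarrier (P 0). e u = 0} \<and>
     (\<forall>i. D (Suc i) ` mcarrier (P (Suc (Suc i))) = {u \<in> mcarrier (P (Suc i)). D i u = 0})"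

text \<open>
  The modules of the resolution are realised on subgroups of \<open>nat \<Rightarrow>\<^sub>0 'a\<close>, which contains a copy
  of every free module of countable rank. This is no restriction: a resolution with \<open>P\<^sub>i\<close> free and
  generated in degree \<open>i\<close> is minimal, and over a connected graded algebra finitely generated in
  degree 1 such \<open>P\<^sub>i\<close> have finite rank.
\<close>

definition homogeneous_Koszul ::
  "('k::field \<Rightarrow> 'a::ring_1) \<Rightarrow> nat \<Rightarrow> (nat \<Rightarrow> 'a) \<Rightarrow> bool" where
  "homogeneous_Koszul \<iota> n x \<longleftrightarrow>
     homogeneous_pre_Koszul \<iota> n x \<and>
     (\<exists>(P :: nat \<Rightarrow> ('a, nat \<Rightarrow>\<^sub>0 'a) graded_mod) D e.
        is_linear_free_resolution (alg_component \<iota> n x) (residue_module \<iota> n x) P D e)"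

end

(*
  A semi-commutative skew PBW extension is a quantum affine space: the scalars are central,
  x_j x_i = q_ij x_i x_j for i < j, and the standard monomials form a basis.  Reordering words
  into standard form uses only these quadratic relations, so by the basis property they generate
  all relations.

  A linear resolution of the residue field is the quantum Koszul complex, whose k-th module is
  free on symbols e_S with |S| = k, in degree k, and whose differential is
      d e_S = sum over s in S of eps(s, S) x_s e_{S - s},
  where eps(s, S) is the product of -1/q_us over u in S, u < s; these twisted signs give d d = 0.
  The complex is graded by exponent vectors, and in each nonzero multidegree it is contracted by
  moving the largest variable x_m of the multidegree into the exterior part.
*)

theory Submission
  imports Defs "HOL-Library.Nat_Bijection"
begin

text \<open>The modules are left modules, so the generators in the differential multiply
  coefficients from the right. The complex thus rests on one product rule, x^a x_s = c x^(a+s),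
  where c collects the price of moving x_s to the left past every x_t with t > s. For the largest
  variable present there is nothing to pass and c = 1; this is why the contraction uses the largest
  variable and not an arbitrary one. The twisted signs are forced: for s < t, the two orders of
  removing s and t from a face produce x_s x_t and x_t x_s = q_st x_s x_t, so one of the two paths
  must carry an extra -1/q_st; it is charged to the larger index. Reordering is carried out modulo
  an unspecified ideal containing the relations. Taken modulo the kernel of evaluation it yields the
  product rule; taken modulo a smaller ideal it shows that the relations generate the kernel. The
  contraction is defined and checked on scalar coordinates, and only on cycles.\<close>

abbreviation "lookup \<equiv> Poly_Mapping.lookup"
abbreviation "keys \<equiv> Poly_Mapping.keys"
abbreviation "single \<equiv> Poly_Mapping.single"

section \<open>Linear extension\<close>

lemma sum_single_lookup: "(\<Sum>k\<in>keys f. single k (lookup f k)) = f"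
  by (rule poly_mapping_eqI) (simp add: lookup_sum lookup_single when_def in_keys_iff)

definition lin_ext :: "('i \<Rightarrow> 's::comm_monoid_add \<Rightarrow> 'm::comm_monoid_add) \<Rightarrow> ('i \<Rightarrow>\<^sub>0 's) \<Rightarrow> 'm" where
  "lin_ext \<phi> f = (\<Sum>k\<in>keys f. \<phi> k (lookup f k))"

text \<open>Assumption \<open>zero\<close> makes sums over \<open>keys f\<close>,
  \<open>keys g\<close> and \<open>keys (f + g)\<close> comparable: terms at cancelling or absent
  keys vanish. The locale serves evaluation of words, lifting to words and combinations of basis
  vectors alike.\<close>

locale additive_family =
  fixes \<phi> :: "'i \<Rightarrow> 's::comm_monoid_add \<Rightarrow> 'm::comm_monoid_add"
  assumes zero [simp]: "\<phi> k 0 = 0" and add: "\<phi> k (a + b) = \<phi> k a + \<phi> k b"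
begin

lemma lin_ext_zero [simp]: "lin_ext \<phi> 0 = 0"
  by (simp add: lin_ext_def)

lemma lin_ext_add: "lin_ext \<phi> (f + g) = lin_ext \<phi> f + lin_ext \<phi> g"
  unfolding lin_ext_def by (rule setsum_keys_plus_distrib) (simp_all add: add)

lemma lin_ext_sum: "lin_ext \<phi> (sum F A) = (\<Sum>a\<in>A. lin_ext \<phi> (F a))"
  by (induction A rule: infinite_finite_induct) (simp_all add: lin_ext_add)

lemma lin_ext_single [simp]: "lin_ext \<phi> (single k c) = \<phi> k c"
  by (simp add: lin_ext_def)

end

section \<open>Reordering words\<close>

definition reorder_rel :: "(nat \<Rightarrow> nat \<Rightarrow> 'k::field) \<Rightarrow> nat \<Rightarrow> nat \<Rightarrow> free_monoid \<Rightarrow>\<^sub>0 'k" where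
  "reorder_rel q i j = single (Word [j, i]) 1 - single (Word [i, j]) (q i j)"

definition std_word :: "nat \<Rightarrow> (nat \<Rightarrow>\<^sub>0 nat) \<Rightarrow> nat list" where
  "std_word m \<alpha> = concat (map (\<lambda>i. replicate (lookup \<alpha> i) i) [1..<Suc m])"

text \<open>The scalar picked up when x_s, placed to the right of the ordered monomial with exponent
  \<alpha>, moves left past all x_t with s < t \<le> m. The bound \<open>m\<close> allows induction
  on the number of variables.\<close>

definition reorder_coeff :: "nat \<Rightarrow> (nat \<Rightarrow> nat \<Rightarrow> 'k::field) \<Rightarrow> nat \<Rightarrow> (nat \<Rightarrow>\<^sub>0 nat) \<Rightarrow> 'k" where
  "reorder_coeff m q s \<alpha> = (\<Prod>t\<in>{s<..m}. q s t ^ lookup \<alpha> t)"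

definition content :: "nat list \<Rightarrow> nat \<Rightarrow>\<^sub>0 nat" where
  "content w = sum_list (map (\<lambda>s. single s 1) w)"

lemma std_word_Suc:
  "std_word (Suc m) \<alpha> = std_word m \<alpha> @ replicate (lookup \<alpha> (Suc m)) (Suc m)"
  by (simp add: std_word_def)

lemma set_std_word: "set (std_word m \<alpha>) \<subseteq> {1..m}"
  by (auto simp: std_word_def)

lemma std_word_cong:
  "(\<And>i. i \<in> {1..m} \<Longrightarrow> lookup \<alpha> i = lookup \<beta> i) \<Longrightarrow> std_word m \<alpha> = std_word m \<beta>"
  unfolding std_word_def by (intro arg_cong[of _ _ concat] map_cong) auto

lemma length_std_word: "length (std_word m \<alpha>) = (\<Sum>i=1..m. lookup \<alpha> i)"
  by (induction m) (auto simp: std_word_Suc, simp add: std_word_def)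

lemma std_word_zero [simp]: "std_word m 0 = []"
  by (induction m) (auto simp: std_word_Suc, simp add: std_word_def)

lemma content_Nil [simp]: "content [] = 0"
  by (simp add: content_def)

lemma content_snoc [simp]: "content (w @ [s]) = content w + single s 1"
  by (simp add: content_def)

lemma keys_content: "keys (content w) \<subseteq> set w"
  by (induction w rule: rev_induct) (use keys_add in fastforce)+

lemma sum_content: "set w \<subseteq> {1..n} \<Longrightarrow> (\<Sum>i=1..n. lookup (content w) i) = length w"
proof (induction w rule: rev_induct)
  case (snoc s w)
  then have "(\<Sum>i=1..n. lookup (single s (1::nat)) i) = 1"
    by (simp add: lookup_single when_def)
  with snoc show ?case by (simp add: lookup_add sum.distrib)
qed auto

lemma lookup_content: "lookup (content w) i = count_list w i"
  by (induction w rule: rev_induct) (auto simp: lookup_add lookup_single when_def)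

lemma content_eq_0_iff: "content w = 0 \<longleftrightarrow> w = []"
proof
  assume "content w = 0"
  then have "count_list w i = 0" for i
    by (simp flip: lookup_content)
  then show "w = []"
    by (metis count_list_0_iff last_in_set)
qed simp

lemma free_algebra_single:
  "set w \<subseteq> {1..n} \<Longrightarrow> single (Word w) c \<in> free_algebra n"
  by (simp add: free_algebra_def)

text \<open>The ideal stays abstract because two instances are needed: the kernel of evaluation, and
  the intersection of that kernel with any ideal containing the relations.\<close>

locale reorder_ideal =
  fixes n :: nat and q :: "nat \<Rightarrow> nat \<Rightarrow> 'k::field" and I
  assumes ideal: "two_sided_ideal n I"
    and rel: "\<And>i j. 1 \<le> i \<Longrightarrow> i < j \<Longrightarrow> j \<le> n \<Longrightarrow> reorder_rel q i j \<in> I"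
begin

lemma zero_mem: "0 \<in> I" and diff_mem: "f \<in> I \<Longrightarrow> g \<in> I \<Longrightarrow> f - g \<in> I"
  using ideal by (auto simp: two_sided_ideal_def add_subgroup_def)

lemma add_mem: "f \<in> I \<Longrightarrow> g \<in> I \<Longrightarrow> f + g \<in> I"
  using diff_mem[of f "0 - g"] diff_mem[of 0 g] zero_mem by auto

lemma sum_mem: "(\<And>a. a \<in> A \<Longrightarrow> F a \<in> I) \<Longrightarrow> sum F A \<in> I"
  by (induction A rule: infinite_finite_induct) (auto simp: zero_mem add_mem)

lemma trans_mem: "f - g \<in> I \<Longrightarrow> g - h \<in> I \<Longrightarrow> f - h \<in> I"
  using add_mem[of "f - g" "g - h"] by simp

lemma swap_mem:
  assumes "1 \<le> i" "i < j" "j \<le> n" "set u \<subseteq> {1..n}" "set v \<subseteq> {1..n}"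
  shows "single (Word (u @ j # i # v)) c - single (Word (u @ i # j # v)) (c * q i j) \<in> I"
proof -
  have "single (Word u) c * reorder_rel q i j * single (Word v) 1 \<in> I"
    using ideal rel[OF assms(1-3)] free_algebra_single[OF assms(4)] free_algebra_single[OF assms(5)]
    unfolding two_sided_ideal_def by blast
  then show ?thesis
    by (simp add: reorder_rel_def algebra_simps mult_single plus_free_monoid_def)
qed

lemma swap_power_mem:
  assumes "1 \<le> i" "i < j" "j \<le> n" "set u \<subseteq> {1..n}" "set v \<subseteq> {1..n}"
  shows "single (Word (u @ replicate a j @ i # v)) c
       - single (Word (u @ i # replicate a j @ v)) (c * q i j ^ a) \<in> I"
  using assms(5)
proof (induction a arbitrary: v c)
  case (Suc a)
  \<comment> \<open>The letter \<open>i\<close> passes one \<open>j\<close> at a time; the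
    \<open>j\<close> just passed joins the tail, hence the induction over arbitrary
    \<open>v\<close>.\<close>
  have "single (Word ((u @ replicate a j) @ j # i # v)) c
      - single (Word ((u @ replicate a j) @ i # j # v)) (c * q i j) \<in> I"
    by (rule swap_mem) (use assms Suc in auto)
  moreover have "single (Word (u @ replicate a j @ i # j # v)) (c * q i j)
      - single (Word (u @ i # replicate a j @ j # v)) (c * q i j * q i j ^ a) \<in> I"
    by (rule Suc.IH) (use assms Suc in auto)
  ultimately show ?case
    using trans_mem by (fastforce simp: replicate_app_Cons_same algebra_simps)
qed (simp add: zero_mem)

text \<open>Induction on \<open>m\<close> peels off the block of the largest letter, which separates
  \<open>s\<close> from its place: \<open>s\<close> jumps over the block at the price of a power of
  \<open>q s (Suc m)\<close>, and the block then becomes part of the tail \<open>v\<close>.\<close>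

lemma std_word_snoc_mem:
  assumes "s \<in> {1..m}" "m \<le> n" "set v \<subseteq> {1..n}"
  shows "single (Word (std_word m \<alpha> @ s # v)) c
       - single (Word (std_word m (\<alpha> + single s 1) @ v)) (c * reorder_coeff m q s \<alpha>) \<in> I"
  using assms
proof (induction m arbitrary: v c)
  case (Suc m)
  let ?r = "replicate (lookup \<alpha> (Suc m)) (Suc m)"
  show ?case
  proof (cases "s = Suc m")
    case True
    have "std_word m (\<alpha> + single s 1) = std_word m \<alpha>"
      using True by (intro std_word_cong) (auto simp: lookup_add lookup_single)
    then show ?thesis
      using True
      by (simp add: std_word_Suc lookup_add reorder_coeff_def zero_mem replicate_app_Cons_same)
  next
    case False
    have "single (Word (std_word m \<alpha> @ ?r @ s # v)) c
        - single (Word (std_word m \<alpha> @ s # ?r @ v)) (c * q s (Suc m) ^ lookup \<alpha> (Suc m)) \<in> I"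
      by (rule swap_power_mem) (use Suc.prems False set_std_word[of m \<alpha>] in auto)
    moreover have "single (Word (std_word m \<alpha> @ s # ?r @ v)) (c * q s (Suc m) ^ lookup \<alpha> (Suc m))
        - single (Word (std_word m (\<alpha> + single s 1) @ ?r @ v))
            (c * q s (Suc m) ^ lookup \<alpha> (Suc m) * reorder_coeff m q s \<alpha>) \<in> I"
      by (rule Suc.IH) (use Suc.prems False in auto)
    moreover have "{s<..Suc m} = insert (Suc m) {s<..m}"
      using False Suc.prems by auto
    then have "reorder_coeff (Suc m) q s \<alpha> = q s (Suc m) ^ lookup \<alpha> (Suc m) * reorder_coeff m q s \<alpha>"
      by (simp add: reorder_coeff_def)
    moreover have "lookup (\<alpha> + single s 1) (Suc m) = lookup \<alpha> (Suc m)"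
      using False by (simp add: lookup_add lookup_single)
    ultimately show ?thesis
      by (simp add: std_word_Suc mult.assoc) (metis trans_mem)
  qed
qed simp

text \<open>Existence of some scalar suffices here, since independence of the standard monomials
  will later determine the coefficients.\<close>

lemma word_reduces:
  assumes "set w \<subseteq> {1..n}"
  shows "\<exists>c'. single (Word w) c - single (Word (std_word n (content w))) c' \<in> I"
  using assms
proof (induction w rule: rev_induct)
  case Nil
  show ?case by (auto intro!: exI[of _ c] simp: zero_mem)
next
  case (snoc s w)
  then obtain c' where "single (Word w) c - single (Word (std_word n (content w))) c' \<in> I"
    by auto
  moreover have "single (Word [s]) 1 \<in> free_algebra n"
    using snoc.prems by (intro free_algebra_single) auto
  ultimately have "(single (Word w) c - single (Word (std_word n (content w))) c')
      * single (Word [s]) 1 \<in> I"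
    using ideal unfolding two_sided_ideal_def by blast
  then have "single (Word (w @ [s])) c - single (Word (std_word n (content w) @ [s])) c' \<in> I"
    by (simp add: algebra_simps mult_single plus_free_monoid_def)
  moreover have "single (Word (std_word n (content w) @ s # [])) c'
       - single (Word (std_word n (content w + single s 1) @ []))
           (c' * reorder_coeff n q s (content w)) \<in> I"
    by (rule std_word_snoc_mem) (use snoc.prems in auto)
  ultimately show ?case
    by (metis append_Nil2 content_snoc trans_mem)
qed

end

text \<open>A section of evaluation: it spells a coordinate vector with ordered words.\<close>

definition std_lift :: "nat \<Rightarrow> ((nat \<Rightarrow>\<^sub>0 nat) \<Rightarrow>\<^sub>0 'k::field) \<Rightarrow> free_monoid \<Rightarrow>\<^sub>0 'k" where
  "std_lift n = lin_ext (\<lambda>\<alpha>. single (Word (std_word n \<alpha>)))"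

interpretation std_lift: additive_family "\<lambda>\<alpha>. single (Word (std_word n \<alpha>)) :: 'k::field \<Rightarrow> _"
  rewrites "lin_ext (\<lambda>\<alpha>. single (Word (std_word n \<alpha>)) :: 'k \<Rightarrow> _) \<equiv> std_lift n"
  by unfold_locales (simp_all add: single_add std_lift_def)

lemma keys_std_lift: "keys (std_lift n g) \<subseteq> (Word \<circ> std_word n) ` keys g"
proof -
  have "keys (std_lift n g) \<subseteq> (\<Union>\<alpha>\<in>keys g. keys (single (Word (std_word n \<alpha>)) (lookup g \<alpha>)))"
    unfolding std_lift_def lin_ext_def by (rule keys_sum)
  then show ?thesis by auto
qed

lemma std_lift_mem: "std_lift n g \<in> free_algebra n"
  using keys_std_lift[of n g] set_std_word[of n] by (fastforce simp: free_algebra_def)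

context reorder_ideal
begin

text \<open>The bound on \<open>keys g\<close> records that reordering preserves the letters of each
  word. Degrees and constant terms are later controlled through it.\<close>

lemma reduces_to_std:
  assumes "f \<in> free_algebra n"
  shows "\<exists>g. keys g \<subseteq> content ` letters ` keys f \<and> f - std_lift n g \<in> I"
proof -
  have "\<exists>c'. single w (lookup f w) - single (Word (std_word n (content (letters w)))) c' \<in> I"
    if "w \<in> keys f" for w
    using word_reduces[of "letters w" "lookup f w"] that assms by (simp add: free_algebra_def)
  then obtain c' where c':
    "\<And>w. w \<in> keys f \<Longrightarrow>
       single w (lookup f w) - single (Word (std_word n (content (letters w)))) (c' w) \<in> I"
    by metis
  let ?g = "\<Sum>w\<in>keys f. single (content (letters w)) (c' w)"
  have "keys ?g \<subseteq> (\<Union>w\<in>keys f. keys (single (content (letters w)) (c' w)))"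
    by (rule keys_sum)
  then have "keys ?g \<subseteq> content ` letters ` keys f"
    by (auto split: if_splits)
  moreover have "f - std_lift n ?g =
      (\<Sum>w\<in>keys f. single w (lookup f w) - single (Word (std_word n (content (letters w)))) (c' w))"
    by (simp add: std_lift.lin_ext_sum sum_subtractf sum_single_lookup)
  then have "f - std_lift n ?g \<in> I"
    by (simp add: sum_mem c')
  ultimately show ?thesis by blast
qed

end

section \<open>Quantum affine space\<close>

lemma prod_list_std_word:
  fixes x :: "nat \<Rightarrow> 'a::monoid_mult"
  shows "prod_list (map x (std_word n \<alpha>)) = std_monomial n x \<alpha>"
proof -
  have "prod_list (map x (concat (map (\<lambda>i. replicate (k i) i) xs))) = prod_list (map (\<lambda>i. x i ^ k i) xs)"
    for k :: "nat \<Rightarrow> nat" and xs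
    by (induction xs) simp_all
  then show ?thesis
    by (simp only: std_word_def std_monomial_def)
qed

lemma std_monomial_zero [simp]: "std_monomial n x 0 = (1::'a::monoid_mult)"
  by (simp flip: prod_list_std_word)

definition exp_sum :: "nat \<Rightarrow> (nat \<Rightarrow>\<^sub>0 nat) \<Rightarrow> nat" where
  "exp_sum n \<alpha> = (\<Sum>i=1..n. lookup \<alpha> i)"

lemma exp_sum_content: "set w \<subseteq> {1..n} \<Longrightarrow> exp_sum n (content w) = length w"
  unfolding exp_sum_def by (rule sum_content)

lemma exp_sum_zero [simp]: "exp_sum n 0 = 0"
  by (simp add: exp_sum_def)

lemma exp_sum_add: "exp_sum n (\<alpha> + \<beta>) = exp_sum n \<alpha> + exp_sum n \<beta>"
  by (simp add: exp_sum_def lookup_add sum.distrib)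

lemma exp_sum_single: "s \<in> {1..n} \<Longrightarrow> exp_sum n (single s k) = k"
  by (simp add: exp_sum_def lookup_single when_def)

lemma exp_sum_eq_0_iff: "\<alpha> \<in> exponents n \<Longrightarrow> exp_sum n \<alpha> = 0 \<longleftrightarrow> \<alpha> = 0"
  unfolding exp_sum_def exponents_def
  by (auto intro!: poly_mapping_eqI simp: subset_iff) (metis atLeastAtMost_iff in_keys_iff One_nat_def)

lemma std_word_eq_Nil_iff: "\<alpha> \<in> exponents n \<Longrightarrow> std_word n \<alpha> = [] \<longleftrightarrow> \<alpha> = 0"
  using exp_sum_eq_0_iff[of \<alpha> n] length_std_word[of n \<alpha>] by (metis exp_sum_def length_0_conv)

lemma content_mem_exponents: "set w \<subseteq> {1..n} \<Longrightarrow> content w \<in> exponents n"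
  using keys_content[of w] by (auto simp: exponents_def)

lemma add_single_mem_exponents:
  "s \<in> {1..n} \<Longrightarrow> \<alpha> + single s k \<in> exponents n \<longleftrightarrow> \<alpha> \<in> exponents n"
  by (auto simp: exponents_def subset_iff in_keys_iff lookup_add lookup_single when_def split: if_splits)

locale quantum_space =
  fixes \<iota> :: "'k::field \<Rightarrow> 'a::ring_1" and n :: nat and x :: "nat \<Rightarrow> 'a" and q :: "nat \<Rightarrow> nat \<Rightarrow> 'k"
  assumes embedding: "ring_embedding \<iota>"
    and basis: "is_basis (\<lambda>r a. \<iota> r * a) UNIV (exponents n) (std_monomial n x)"
    and commutes_gen: "i \<in> {1..n} \<Longrightarrow> x i * \<iota> r = \<iota> r * x i"
    and gen_swap: "1 \<le> i \<Longrightarrow> i < j \<Longrightarrow> j \<le> n \<Longrightarrow> x j * x i = \<iota> (q i j) * x i * x j"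
    and q_nonzero: "1 \<le> i \<Longrightarrow> i < j \<Longrightarrow> j \<le> n \<Longrightarrow> q i j \<noteq> 0"
begin

lemma iota_add: "\<iota> (r + s) = \<iota> r + \<iota> s"
  and iota_mult: "\<iota> (r * s) = \<iota> r * \<iota> s"
  and iota_one [simp]: "\<iota> 1 = 1"
  using embedding by (auto simp: ring_embedding_def)

lemma iota_zero [simp]: "\<iota> 0 = 0"
  using iota_add[of 0 0] by simp

lemma iota_uminus: "\<iota> (- r) = - \<iota> r"
  using iota_add[of r "- r"] by (simp add: eq_neg_iff_add_eq_0 add.commute)

section \<open>Coordinates in the basis of standard monomials\<close>

definition combo :: "((nat \<Rightarrow>\<^sub>0 nat) \<Rightarrow>\<^sub>0 'k) \<Rightarrow> 'a" where
  "combo = lin_ext (\<lambda>\<alpha> c. \<iota> c * std_monomial n x \<alpha>)"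

sublocale combo: additive_family "\<lambda>\<alpha> c. \<iota> c * std_monomial n x \<alpha>"
  rewrites "lin_ext (\<lambda>\<alpha> c. \<iota> c * std_monomial n x \<alpha>) \<equiv> combo"
  by unfold_locales (simp_all add: iota_add algebra_simps combo_def)

definition coords :: "'a \<Rightarrow> (nat \<Rightarrow>\<^sub>0 nat) \<Rightarrow>\<^sub>0 'k" where
  "coords a = (THE g. keys g \<subseteq> exponents n \<and> a = combo g)"

lemma coords_unique_exists: "\<exists>!g. keys g \<subseteq> exponents n \<and> a = combo g"
  using basis unfolding is_basis_def combo_def lin_ext_def by auto

lemma keys_coords: "keys (coords a) \<subseteq> exponents n"
  and combo_coords: "combo (coords a) = a"
  using theI'[OF coords_unique_exists[of a]] by (auto simp: coords_def)

lemma coords_combo: "keys g \<subseteq> exponents n \<Longrightarrow> coords (combo g) = g"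
  using coords_unique_exists[of "combo g"] keys_coords combo_coords by metis

lemma coords_add: "coords (a + b) = coords a + coords b"
proof -
  have "combo (coords a + coords b) = a + b"
    by (simp add: combo.lin_ext_add combo_coords)
  moreover have "keys (coords a + coords b) \<subseteq> exponents n"
    using keys_add[of "coords a" "coords b"] keys_coords by blast
  ultimately show ?thesis
    using coords_combo by metis
qed

lemma coords_zero [simp]: "coords 0 = 0"
  using coords_combo[of 0] by simp

lemma coords_sum: "coords (sum F A) = (\<Sum>a\<in>A. coords (F a))"
  by (induction A rule: infinite_finite_induct) (simp_all add: coords_add)

lemma coords_diff: "coords (a - b) = coords a - coords b"
  using coords_add[of "a - b" b] by (simp add: algebra_simps)

lemma coords_monomial: "\<alpha> \<in> exponents n \<Longrightarrow> coords (\<iota> c * std_monomial n x \<alpha>) = single \<alpha> c"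
  using coords_combo[of "single \<alpha> c"] by (simp split: if_splits)

lemma coords_iota: "coords (\<iota> c) = single 0 c"
  using coords_monomial[of 0 c] by (simp add: exponents_def)

lemma coords_inject: "coords a = coords b \<longleftrightarrow> a = b"
  by (metis combo_coords)

lemma combo_alt: "a = (\<Sum>\<alpha>\<in>keys (coords a). \<iota> (lookup (coords a) \<alpha>) * std_monomial n x \<alpha>)"
  using combo_coords[of a] by (simp add: combo_def lin_ext_def)

lemma coords_scale: "lookup (coords (\<iota> r * a)) \<alpha> = r * lookup (coords a) \<alpha>"
proof -
  have "\<iota> r * a = (\<Sum>\<beta>\<in>keys (coords a). \<iota> (r * lookup (coords a) \<beta>) * std_monomial n x \<beta>)"
    by (subst combo_alt[of a]) (simp add: sum_distrib_left iota_mult mult.assoc)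
  then have "coords (\<iota> r * a) = (\<Sum>\<beta>\<in>keys (coords a). single \<beta> (r * lookup (coords a) \<beta>))"
    using keys_coords[of a] by (simp add: coords_sum coords_monomial subset_iff)
  then show ?thesis
    by (simp add: lookup_sum lookup_single when_def in_keys_iff)
qed

text \<open>Commutation with the generators passes to standard monomials factor by factor, and to
  the whole ring through the basis, the scalars commuting among themselves.\<close>

lemma iota_central: "\<iota> r * a = a * \<iota> r"
proof -
  have "prod_list ys * \<iota> r = \<iota> r * prod_list ys" if "\<forall>y\<in>set ys. y * \<iota> r = \<iota> r * y" for ys
    using that
  proof (induction ys)
    case (Cons y ys)
    from Cons.prems have y: "y * \<iota> r = \<iota> r * y" by simp
    from Cons have ys: "prod_list ys * \<iota> r = \<iota> r * prod_list ys" by simp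
    have "prod_list (y # ys) * \<iota> r = y * (prod_list ys * \<iota> r)"
      by (simp only: prod_list.Cons mult.assoc)
    also have "\<dots> = (y * \<iota> r) * prod_list ys"
      by (simp only: ys mult.assoc)
    also have "\<dots> = \<iota> r * prod_list (y # ys)"
      by (simp only: y prod_list.Cons mult.assoc)
    finally show ?case .
  qed simp
  note prod_list = this
  have monomial: "std_monomial n x \<alpha> * \<iota> r = \<iota> r * std_monomial n x \<alpha>" for \<alpha>
    unfolding std_monomial_def
    by (rule prod_list) (auto intro!: power_commuting_commutes commutes_gen)
  have "\<iota> r * (\<iota> c * std_monomial n x \<alpha>) = \<iota> c * std_monomial n x \<alpha> * \<iota> r" for c \<alpha>
  proof -
    have "\<iota> r * (\<iota> c * std_monomial n x \<alpha>) = \<iota> (c * r) * std_monomial n x \<alpha>"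
      by (simp only: iota_mult mult.assoc[symmetric] mult.commute[of c r])
    then show ?thesis
      by (simp add: iota_mult mult.assoc monomial)
  qed
  then have "\<iota> r * (\<Sum>\<alpha>\<in>keys (coords a). \<iota> (lookup (coords a) \<alpha>) * std_monomial n x \<alpha>)
           = (\<Sum>\<alpha>\<in>keys (coords a). \<iota> (lookup (coords a) \<alpha>) * std_monomial n x \<alpha>) * \<iota> r"
    by (simp only: sum_distrib_left sum_distrib_right)
  then show ?thesis by (simp only: combo_alt[of a, symmetric])
qed

lemma iota_left_commute: "a * (\<iota> r * b) = \<iota> r * (a * b)"
  by (simp only: mult.assoc[symmetric] iota_central[of r a])

section \<open>Evaluation of words and multiplication by a generator\<close>

sublocale eval: additive_family "\<lambda>w c. \<iota> c * prod_list (map x (letters w))"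
  rewrites "lin_ext (\<lambda>w c. \<iota> c * prod_list (map x (letters w))) \<equiv> free_eval \<iota> x"
proof -
  show "additive_family (\<lambda>w c. \<iota> c * prod_list (map x (letters w)))"
    by unfold_locales (simp_all add: iota_add algebra_simps)
  show "lin_ext (\<lambda>w c. \<iota> c * prod_list (map x (letters w))) \<equiv> free_eval \<iota> x"
    by (rule eq_reflection) (simp add: fun_eq_iff lin_ext_def free_eval_def)
qed

lemma free_eval_diff: "free_eval \<iota> x (f - g) = free_eval \<iota> x f - free_eval \<iota> x g"
  using eval.lin_ext_add[of "f - g" g] by simp

text \<open>On single words this is centrality of the scalars, which lets the second coefficient
  pass the first word; both sides are biadditive.\<close>

lemma free_eval_mult: "free_eval \<iota> x (f * g) = free_eval \<iota> x f * free_eval \<iota> x g"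
proof -
  have single: "free_eval \<iota> x (single u c * single v d)
      = free_eval \<iota> x (single u c) * free_eval \<iota> x (single v d)" for u v c d
    by (simp add: mult_single plus_free_monoid_def iota_mult mult.assoc
        iota_left_commute[of "prod_list _"])
  have "free_eval \<iota> x (sum F A * sum G B) = free_eval \<iota> x (sum F A) * free_eval \<iota> x (sum G B)"
    if "\<And>u v. u \<in> A \<Longrightarrow> v \<in> B \<Longrightarrow> free_eval \<iota> x (F u * G v) = free_eval \<iota> x (F u) * free_eval \<iota> x (G v)"
    for F G :: "free_monoid \<Rightarrow> free_monoid \<Rightarrow>\<^sub>0 'k" and A B
    using that by (simp add: sum_product eval.lin_ext_sum)
  from this[of "keys f" "keys g" "\<lambda>u. single u (lookup f u)" "\<lambda>v. single v (lookup g v)"]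
  show ?thesis by (simp add: single sum_single_lookup)
qed

lemma free_eval_std_lift: "free_eval \<iota> x (std_lift n g) = combo g"
  by (simp add: std_lift_def lin_ext_def eval.lin_ext_sum prod_list_std_word combo_def)

definition relations :: "(free_monoid \<Rightarrow>\<^sub>0 'k) set" where
  "relations = {f \<in> free_algebra n. free_eval \<iota> x f = 0}"

lemma two_sided_ideal_relations: "two_sided_ideal n relations"
proof -
  have "f - g \<in> free_algebra n" if "f \<in> free_algebra n" "g \<in> free_algebra n"
    for f g :: "free_monoid \<Rightarrow>\<^sub>0 'k"
    using that keys_diff[of f g] by (auto simp: free_algebra_def)
  moreover have "f * g \<in> free_algebra n" if "f \<in> free_algebra n" "g \<in> free_algebra n"
    for f g :: "free_monoid \<Rightarrow>\<^sub>0 'k"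
    using that keys_mult[of f g] by (fastforce simp: free_algebra_def plus_free_monoid_def)
  moreover have "(0 :: free_monoid \<Rightarrow>\<^sub>0 'k) \<in> free_algebra n"
    by (simp add: free_algebra_def)
  ultimately show ?thesis
    by (auto simp: two_sided_ideal_def relations_def add_subgroup_def free_eval_diff free_eval_mult)
qed

lemma reorder_rel_mem_relations:
  assumes "1 \<le> i" "i < j" "j \<le> n"
  shows "reorder_rel q i j \<in> relations"
proof -
  have "reorder_rel q i j \<in> free_algebra n"
    using keys_diff[of "single (Word [j, i]) 1" "single (Word [i, j]) (q i j)"] assms
    by (fastforce simp: reorder_rel_def free_algebra_def split: if_splits)
  moreover have "free_eval \<iota> x (reorder_rel q i j) = 0"
    using gen_swap[OF assms] by (simp add: reorder_rel_def free_eval_diff mult.assoc)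
  ultimately show ?thesis by (simp add: relations_def)
qed

sublocale relations: reorder_ideal n q relations
  by unfold_locales (simp_all add: two_sided_ideal_relations reorder_rel_mem_relations)

lemma free_eval_eq: "f - g \<in> relations \<Longrightarrow> free_eval \<iota> x f = free_eval \<iota> x g"
  by (simp add: relations_def free_eval_diff)

text \<open>The reordering congruence for the word of \<alpha> followed by \<open>s\<close>, read
  modulo the kernel of evaluation, becomes an equation in the ring.\<close>

lemma monomial_mult_gen:
  assumes "s \<in> {1..n}"
  shows "std_monomial n x \<alpha> * x s = \<iota> (reorder_coeff n q s \<alpha>) * std_monomial n x (\<alpha> + single s 1)"
  using free_eval_eq[OF relations.std_word_snoc_mem[of s n "[]" \<alpha> 1]] assms
  by (simp add: prod_list_std_word)

text \<open>Right multiplication by x_s shifts exponents, so the coordinate at \<gamma> can only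
  come from \<gamma> minus one \<open>s\<close>. The case split is needed because subtraction of
  exponents truncates at zero. The scalar involves exponents beyond \<open>s\<close> only, so it may
  be read off at \<gamma> itself.\<close>

lemma coords_mult_gen:
  assumes "s \<in> {1..n}"
  shows "lookup (coords (a * x s)) \<gamma> =
    (if lookup \<gamma> s = 0 then 0
     else reorder_coeff n q s \<gamma> * lookup (coords a) (\<gamma> - single s 1))"
proof -
  let ?c = "coords a"
  have "a * x s = (\<Sum>\<alpha>\<in>keys ?c.
      \<iota> (lookup ?c \<alpha> * reorder_coeff n q s \<alpha>) * std_monomial n x (\<alpha> + single s 1))"
    by (subst combo_alt[of a])
       (simp add: sum_distrib_right mult.assoc monomial_mult_gen[OF assms] iota_mult)
  moreover have "\<alpha> + single s 1 \<in> exponents n" if "\<alpha> \<in> keys ?c" for \<alpha>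
    using that keys_coords[of a] add_single_mem_exponents[OF assms] by blast
  ultimately have "coords (a * x s) =
      (\<Sum>\<alpha>\<in>keys ?c. single (\<alpha> + single s 1) (lookup ?c \<alpha> * reorder_coeff n q s \<alpha>))"
    by (simp add: coords_sum coords_monomial)
  then have eq: "lookup (coords (a * x s)) \<gamma> =
      (\<Sum>\<alpha>\<in>keys ?c. lookup ?c \<alpha> * reorder_coeff n q s \<alpha> when \<alpha> + single s 1 = \<gamma>)"
    by (simp add: lookup_sum lookup_single)
  show ?thesis
  proof (cases "lookup \<gamma> s = 0")
    case True
    then have "\<alpha> + single s 1 \<noteq> \<gamma>" for \<alpha>
      by (auto simp: lookup_add)
    with True show ?thesis by (simp add: eq)
  next
    case False
    have *: "\<alpha> + single s 1 = \<gamma> \<longleftrightarrow> \<alpha> = \<gamma> - single s 1" for \<alpha>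
      using False
      by (auto simp: poly_mapping_eq_iff fun_eq_iff lookup_add lookup_minus lookup_single when_def)
    have "reorder_coeff n q s (\<gamma> - single s 1) = reorder_coeff n q s \<gamma>"
      by (auto simp: reorder_coeff_def lookup_minus lookup_single intro!: prod.cong)
    with False show ?thesis
      by (simp add: eq * when_def in_keys_iff mult.commute del: One_nat_def)
  qed
qed

lemma free_eval_combo:
  assumes "f \<in> free_algebra n"
  obtains g where "keys g \<subseteq> content ` letters ` keys f" "keys g \<subseteq> exponents n"
    "free_eval \<iota> x f = combo g" "f - std_lift n g \<in> relations"
proof -
  obtain g where g: "keys g \<subseteq> content ` letters ` keys f" "f - std_lift n g \<in> relations"
    using relations.reduces_to_std[OF assms] by blast
  moreover have "content ` letters ` keys f \<subseteq> exponents n"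
    using assms by (auto simp: free_algebra_def simp del: One_nat_def intro: content_mem_exponents)
  ultimately show thesis
    using that[OF g(1) _ _ g(2)] free_eval_eq[OF g(2)] by (auto simp: free_eval_std_lift)
qed

section \<open>Grading and residue map in coordinates\<close>

lemma free_eval_coords: "free_eval \<iota> x (std_lift n (coords a)) = a"
  by (simp add: free_eval_std_lift combo_coords)

lemma mem_free_eval_imageI: "std_lift n (coords a) \<in> F \<Longrightarrow> a \<in> free_eval \<iota> x ` F"
  using imageI[of "std_lift n (coords a)" F "free_eval \<iota> x"] by (simp add: free_eval_coords)

text \<open>One direction holds because reduction to ordered words preserves length, the other
  because the ordered lift of such an element is homogeneous.\<close>

lemma alg_component_iff:
  "a \<in> alg_component \<iota> n x d \<longleftrightarrow> (\<forall>\<gamma>\<in>keys (coords a). exp_sum n \<gamma> = d)"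
proof
  assume "a \<in> alg_component \<iota> n x d"
  then obtain f where f: "f \<in> free_component n d" "a = free_eval \<iota> x f"
    by (auto simp: alg_component_def)
  then have fa: "f \<in> free_algebra n" by (simp add: free_component_def)
  obtain g where g: "keys g \<subseteq> content ` letters ` keys f" "keys g \<subseteq> exponents n"
    "free_eval \<iota> x f = combo g" using free_eval_combo[OF fa] by blast
  have "coords a = g" using g f coords_combo by simp
  then show "\<forall>\<gamma>\<in>keys (coords a). exp_sum n \<gamma> = d"
    using g(1) f(1) by (fastforce simp: free_component_def free_algebra_def exp_sum_content)
next
  assume *: "\<forall>\<gamma>\<in>keys (coords a). exp_sum n \<gamma> = d"
  have "std_lift n (coords a) \<in> free_component n d"
    using keys_std_lift[of n "coords a"] * std_lift_mem[of n "coords a"]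
    by (fastforce simp: free_component_def length_std_word exp_sum_def)
  then show "a \<in> alg_component \<iota> n x d"
    unfolding alg_component_def by (rule mem_free_eval_imageI)
qed

lemma alg_component_mult:
  assumes "a \<in> alg_component \<iota> n x d" "b \<in> alg_component \<iota> n x e"
  shows "a * b \<in> alg_component \<iota> n x (d + e)"
proof -
  obtain f g where "f \<in> free_component n d" "g \<in> free_component n e"
    and ab: "a = free_eval \<iota> x f" "b = free_eval \<iota> x g"
    using assms by (auto simp: alg_component_def)
  then have "f * g \<in> free_component n (d + e)"
    using keys_mult[of f g] by (fastforce simp: free_component_def free_algebra_def plus_free_monoid_def)
  then show ?thesis
    by (auto simp: alg_component_def ab simp flip: free_eval_mult)
qed

text \<open>Only the empty word has content zero, so reordering neither creates nor destroys a
  constant term.\<close>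

lemma irrelevant_ideal_iff: "a \<in> irrelevant_ideal \<iota> n x \<longleftrightarrow> lookup (coords a) 0 = 0"
proof
  assume "a \<in> irrelevant_ideal \<iota> n x"
  then obtain f where f: "f \<in> free_algebra n" "lookup f (Word []) = 0" "a = free_eval \<iota> x f"
    by (auto simp: irrelevant_ideal_def)
  obtain g where g: "keys g \<subseteq> content ` letters ` keys f" "keys g \<subseteq> exponents n"
    "free_eval \<iota> x f = combo g" using free_eval_combo[OF f(1)] by blast
  have "coords a = g" using g f coords_combo by simp
  moreover have "0 \<notin> content ` letters ` keys f"
    using f(2) by (auto simp: in_keys_iff) (metis content_eq_0_iff free_monoid.collapse)
  ultimately show "lookup (coords a) 0 = 0"
    using g(1) by (auto simp: in_keys_iff)
next
  assume *: "lookup (coords a) 0 = 0"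
  have "Word [] \<notin> (Word \<circ> std_word n) ` keys (coords a)"
  proof
    assume "Word [] \<in> (Word \<circ> std_word n) ` keys (coords a)"
    then obtain \<alpha> where "\<alpha> \<in> keys (coords a)" "std_word n \<alpha> = []" by auto
    then have "0 \<in> keys (coords a)"
      using keys_coords[of a] std_word_eq_Nil_iff[of \<alpha> n] by auto
    then show False using * by (simp add: in_keys_iff)
  qed
  then have "lookup (std_lift n (coords a)) (Word []) = 0"
    using keys_std_lift[of n "coords a"] by (auto simp: in_keys_iff)
  then show "a \<in> irrelevant_ideal \<iota> n x"
    unfolding irrelevant_ideal_def
    by (intro mem_free_eval_imageI) (simp add: std_lift_mem)
qed

lemma residue_map_eq: "residue_map \<iota> n x a = lookup (coords a) 0"
  unfolding residue_map_def irrelevant_ideal_iff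
  by (simp add: coords_diff coords_iota lookup_minus)

text \<open>A nontrivial standard monomial ends in a generator, and right multiplication by a
  generator kills the constant coordinate. Expanding \<open>b\<close> in the basis thus leaves only
  its constant term.\<close>

lemma residue_map_mult: "residue_map \<iota> n x (a * b) = residue_map \<iota> n x a * residue_map \<iota> n x b"
proof -
  have mono: "lookup (coords (a * std_monomial n x \<alpha>)) 0 = (lookup (coords a) 0 when \<alpha> = 0)"
    if \<alpha>: "\<alpha> \<in> exponents n" for \<alpha>
  proof (cases "\<alpha> = 0")
    case False
    then obtain w s where ws: "std_word n \<alpha> = w @ [s]"
      using std_word_eq_Nil_iff[OF \<alpha>] by (cases "std_word n \<alpha>" rule: rev_cases) auto
    then have "s \<in> {1..n}"
      using set_std_word[of n \<alpha>] by auto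
    then have "lookup (coords (a * prod_list (map x w) * x s)) 0 = 0"
      by (simp add: coords_mult_gen)
    then show ?thesis
      using False by (simp add: ws mult.assoc flip: prod_list_std_word)
  qed simp
  have "a * b = (\<Sum>\<alpha>\<in>keys (coords b). \<iota> (lookup (coords b) \<alpha>) * (a * std_monomial n x \<alpha>))"
    by (subst combo_alt[of b]) (simp only: sum_distrib_left iota_left_commute[of a])
  then have "lookup (coords (a * b)) 0 =
      (\<Sum>\<alpha>\<in>keys (coords b). lookup (coords b) \<alpha> * lookup (coords (a * std_monomial n x \<alpha>)) 0)"
    by (simp add: coords_sum lookup_sum coords_scale)
  also have "\<dots> = (\<Sum>\<alpha>\<in>keys (coords b). (lookup (coords b) 0 * lookup (coords a) 0 when \<alpha> = 0))"
    using keys_coords[of b] by (intro sum.cong) (auto simp: mono when_def)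
  also have "\<dots> = lookup (coords a) 0 * lookup (coords b) 0"
    by (simp add: when_def in_keys_iff mult.commute)
  finally show ?thesis by (simp add: residue_map_eq)
qed

section \<open>Quadratic presentation\<close>

lemma reorder_rel_mem_quadratic_forms:
  assumes "1 \<le> i" "i < j" "j \<le> n"
  shows "reorder_rel q i j \<in> quadratic_forms n"
proof -
  \<comment> \<open>Nested conditionals rather than conjunctions, so that the two sums collapse one
    after the other.\<close>
  let ?c = "\<lambda>a b. (if a = j then (if b = i then 1 else 0) else 0)
                 - (if a = i then (if b = j then q i j else 0) else 0)"
  have delta: "(\<Sum>a=1..n. \<Sum>b=1..n. single (Word [a, b]) (if a = k then (if b = l then r else 0) else 0))
      = single (Word [k, l]) r"
    if "k \<in> {1..n}" "l \<in> {1..n}" for k l and r :: 'k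
  proof -
    have "single (Word [a, b]) (if a = k then (if b = l then r else 0) else 0)
        = (if a = k then (if b = l then single (Word [k, l]) r else 0) else 0)" for a b
      by auto
    moreover have "(\<Sum>b=1..n. if a = k then (if b = l then single (Word [k, l]) r else 0) else 0)
        = (if a = k then single (Word [k, l]) r else 0)" for a
      using that by auto
    ultimately show ?thesis using that by (simp only: sum.delta finite_atLeastAtMost if_True)
  qed
  have eq: "(\<Sum>a=1..n. \<Sum>b=1..n. single (Word [a, b]) (?c a b)) = reorder_rel q i j"
    using assms by (simp only: single_diff sum_subtractf) (subst (1 2) delta, auto simp: reorder_rel_def)
  show ?thesis
    unfolding quadratic_forms_def
    by (rule CollectI, rule exI[of _ ?c], rule conjI[OF eq[symmetric] TrueI])
qed

lemma pre_Koszul: "homogeneous_pre_Koszul \<iota> n x"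
proof -
  let ?R = "{reorder_rel q i j | i j. 1 \<le> i \<and> i < j \<and> j \<le> n}"
  have "relations = generated_ideal n ?R"
  proof
    show "generated_ideal n ?R \<subseteq> relations"
      using two_sided_ideal_relations reorder_rel_mem_relations
      by (auto simp: generated_ideal_def)
    have "f \<in> I" if f: "f \<in> relations" and I: "two_sided_ideal n I" "?R \<subseteq> I" for f I
    proof -
      \<comment> \<open>Reducing \<open>f\<close> modulo the intersection keeps the remainder under
        control on both sides: lying in the kernel forces \<open>combo g = 0\<close>, hence
        \<open>g = 0\<close> by independence, and then \<open>f\<close> itself lies in
        \<open>I\<close>.\<close>
      define J where "J = I \<inter> relations"
      interpret J: reorder_ideal n q J
      proof
        show "two_sided_ideal n J"
          using I(1) two_sided_ideal_relations
          unfolding J_def two_sided_ideal_def add_subgroup_def by blast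
        show "reorder_rel q i j \<in> J" if "1 \<le> i" "i < j" "j \<le> n" for i j
          using that I(2) reorder_rel_mem_relations unfolding J_def by blast
      qed
      have fa: "f \<in> free_algebra n" using f by (simp add: relations_def)
      obtain g where g: "keys g \<subseteq> content ` letters ` keys f" "f - std_lift n g \<in> J"
        using J.reduces_to_std[OF fa] by blast
      have "keys g \<subseteq> exponents n"
        using g(1) fa content_mem_exponents[of _ n] unfolding free_algebra_def by blast
      moreover have "combo g = 0"
        using f free_eval_eq[of f "std_lift n g"] g(2)
        by (simp add: J_def relations_def free_eval_std_lift)
      ultimately have "g = 0" using coords_combo[of g] by simp
      then show ?thesis using g(2) by (simp add: J_def)
    qed
    then show "relations \<subseteq> generated_ideal n ?R"
      by (auto simp: generated_ideal_def)
  qed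
  moreover have "?R \<subseteq> quadratic_forms n"
    using reorder_rel_mem_quadratic_forms by auto
  moreover have "free_eval \<iota> x ` free_algebra n = UNIV"
  proof -
    have "a \<in> free_eval \<iota> x ` free_algebra n" for a
      by (rule mem_free_eval_imageI[OF std_lift_mem])
    then show ?thesis by blast
  qed
  ultimately show ?thesis
    unfolding homogeneous_pre_Koszul_def
    using embedding iota_central by (auto simp: relations_def)
qed

end

section \<open>The quantum Koszul complex\<close>

lemma lookup_single_0_mult: "lookup (single (0::nat) a * u) t = a * lookup (u :: nat \<Rightarrow>\<^sub>0 'a::ring_1) t"
proof -
  have "single 0 a * u = Poly_Mapping.map ((*) a) u"
    by (simp only: mult_map_scale_conv_mult)
  then show ?thesis
    by (simp add: map.rep_eq when_def)
qed

lemma lookup_sum_single_keys: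
  assumes "\<phi> 0 = 0"
  shows "lookup (\<Sum>t\<in>keys u. single t (\<phi> (lookup u t))) t = \<phi> (lookup u t)"
  using assms by (simp add: lookup_sum lookup_single when_def in_keys_iff)

lemma is_basis_single:
  "is_basis (\<lambda>a u. single 0 a * u) {u :: nat \<Rightarrow>\<^sub>0 'a::ring_1. keys u \<subseteq> T} ((\<lambda>t. single t 1) ` T) (\<lambda>e. e)"
proof -
  let ?E = "(\<lambda>t. single t 1 :: nat \<Rightarrow>\<^sub>0 'a) ` T"
  let ?sum = "\<lambda>c. \<Sum>e\<in>keys c. single 0 (lookup c e) * e"
  interpret additive_family "\<lambda>e a. single 0 a * e :: nat \<Rightarrow>\<^sub>0 'a"
    by unfold_locales (simp_all add: single_add distrib_right)
  \<comment> \<open>The basis is indexed by its own vectors, so distinct positions must give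
    distinct vectors; this uses 1 \<noteq> 0 in the ring.\<close>
  have inj: "single s (1::'a) = single t 1 \<longleftrightarrow> s = t" for s t :: nat
    by (metis lookup_single_eq lookup_single_not_eq zero_neq_one)
  have lookup_combination: "lookup (?sum c) t = lookup c (single t 1)" if "keys c \<subseteq> ?E" for c t
  proof -
    have "lookup (?sum c) t = (\<Sum>e\<in>keys c. lookup c e * lookup e t)"
      by (simp add: lookup_sum lookup_single_0_mult)
    also have "\<dots> = (\<Sum>e\<in>keys c. if e = single t 1 then lookup c (single t 1) else 0)"
      using that by (intro sum.cong) (auto simp: lookup_single when_def inj)
    finally show ?thesis by (simp add: in_keys_iff)
  qed
  have "\<exists>!c. keys c \<subseteq> ?E \<and> m = ?sum c" if m: "keys m \<subseteq> T" for m
  proof (rule ex_ex1I)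
    let ?c = "\<Sum>t\<in>keys m. single (single t 1) (lookup m t)"
    have "keys ?c \<subseteq> (\<Union>t\<in>keys m. keys (single (single t (1::'a)) (lookup m t)))"
      by (rule keys_sum)
    then have keys: "keys ?c \<subseteq> ?E"
      using m by (auto split: if_splits)
    have "?sum ?c = (\<Sum>t\<in>keys m. single 0 (lookup m t) * single t 1)"
      using lin_ext_sum[of "\<lambda>t. single (single t 1) (lookup m t)" "keys m"]
      by (simp only: lin_ext_single) (simp only: lin_ext_def)
    then have sum: "m = ?sum ?c"
      by (simp only: mult_single add_0_left mult_1_right sum_single_lookup)
    show "\<exists>c. keys c \<subseteq> ?E \<and> m = ?sum c"
      by (rule exI[of _ ?c]) (rule conjI[OF keys sum])
  next
    fix c d
    assume "keys c \<subseteq> ?E \<and> m = ?sum c" and "keys d \<subseteq> ?E \<and> m = ?sum d"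
    then have c: "keys c \<subseteq> ?E" "lookup m t = lookup (?sum c) t"
      and d: "keys d \<subseteq> ?E" "lookup m t = lookup (?sum d) t" for t
      by simp_all
    show "c = d"
    proof (rule poly_mapping_eqI)
      fix e
      show "lookup c e = lookup d e"
      proof (cases "e \<in> ?E")
        case True
        then obtain t where e: "e = single t 1" by blast
        show ?thesis
          unfolding e lookup_combination[OF c(1), symmetric] lookup_combination[OF d(1), symmetric]
          by (rule trans[OF c(2)[symmetric] d(2)])
      next
        case False
        then have "e \<notin> keys c" "e \<notin> keys d" using c d by blast+
        then show ?thesis by (simp add: in_keys_iff)
      qed
    qed
  qed
  then show ?thesis
    unfolding is_basis_def by auto
qed

text \<open>Splitting at the diagonal and swapping the order of summation in one half pairs each
  term with its mirror image. Showing that the sum equals its own negative would not do in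
  characteristic 2.\<close>

lemma sum_antisymmetric:
  fixes F :: "nat \<Rightarrow> nat \<Rightarrow> 'b::ab_group_add"
  assumes "finite A" and "\<And>s t. s \<in> A \<Longrightarrow> t \<in> A \<Longrightarrow> s < t \<Longrightarrow> F s t + F t s = 0"
  shows "(\<Sum>t\<in>A. \<Sum>s\<in>A - {t}. F s t) = 0"
proof -
  have "(\<Sum>t\<in>A. \<Sum>s\<in>A - {t}. F s t) = (\<Sum>t\<in>A. (\<Sum>s\<in>A. if s < t then F s t else 0) + (\<Sum>s\<in>A. if t < s then F s t else 0))"
  proof (rule sum.cong[OF refl])
    fix t assume "t \<in> A"
    have "(\<Sum>s\<in>A - {t}. F s t) = (\<Sum>s\<in>A. (if s < t then F s t else 0) + (if t < s then F s t else 0))"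
      using assms(1) by (intro sum.mono_neutral_cong_left) auto
    then show "(\<Sum>s\<in>A - {t}. F s t) = (\<Sum>s\<in>A. if s < t then F s t else 0) + (\<Sum>s\<in>A. if t < s then F s t else 0)"
      by (simp add: sum.distrib)
  qed
  also have "\<dots> = (\<Sum>t\<in>A. \<Sum>s\<in>A. if s < t then F s t else 0) + (\<Sum>t\<in>A. \<Sum>s\<in>A. if t < s then F s t else 0)"
    by (rule sum.distrib)
  also have "(\<Sum>t\<in>A. \<Sum>s\<in>A. if t < s then F s t else 0) = (\<Sum>t\<in>A. \<Sum>s\<in>A. if s < t then F t s else 0)"
    by (rule sum.swap)
  also have "(\<Sum>t\<in>A. \<Sum>s\<in>A. if s < t then F s t else 0) + (\<Sum>t\<in>A. \<Sum>s\<in>A. if s < t then F t s else 0)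
      = (\<Sum>t\<in>A. \<Sum>s\<in>A. if s < t then F s t + F t s else 0)"
    unfolding sum.distrib[symmetric] by (intro sum.cong) auto
  also have "\<dots> = 0"
    using assms(2) by (intro sum.neutral ballI) auto
  finally show ?thesis .
qed

context quantum_space
begin

text \<open>
  The basis symbol \<open>e\<^sub>S\<close> is the element \<open>1\<close> at index \<open>set_encode S\<close>. The ring structure of
  \<open>nat \<Rightarrow>\<^sub>0 'a\<close> plays no role except that multiplication by \<open>single 0 a\<close> is the left action of \<open>a\<close>.
\<close>

definition faces :: "nat \<Rightarrow> nat set set" where
  "faces k = {S. S \<subseteq> {1..n} \<and> card S = k}"

text \<open>The sum runs over faces of all sizes, so that a single formula for the differential
  serves every degree of the complex.\<close>

definition tuple :: "(nat set \<Rightarrow> 'a) \<Rightarrow> nat \<Rightarrow>\<^sub>0 'a" where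
  "tuple g = (\<Sum>S\<in>Pow {1..n}. single (set_encode S) (g S))"

definition chains :: "nat \<Rightarrow> (nat \<Rightarrow>\<^sub>0 'a) set" where
  "chains k = {u. keys u \<subseteq> set_encode ` faces k}"

definition coef :: "(nat \<Rightarrow>\<^sub>0 'a) \<Rightarrow> nat \<Rightarrow> (nat \<Rightarrow>\<^sub>0 nat) \<Rightarrow> 'k" where
  "coef u t = lookup (coords (lookup u t))"

text \<open>The summand \<open>k\<close> is the degree of the symbols e_S with |S| =
  \<open>k\<close>: the module is a sum of copies of the algebra shifted by
  \<open>k\<close>.\<close>

definition chain_component :: "nat \<Rightarrow> nat \<Rightarrow> (nat \<Rightarrow>\<^sub>0 'a) set" where
  "chain_component k j = {u \<in> chains k. \<forall>t \<gamma>. coef u t \<gamma> \<noteq> 0 \<longrightarrow> exp_sum n \<gamma> + k = j}"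

definition koszul :: "nat \<Rightarrow> ('a, nat \<Rightarrow>\<^sub>0 'a) graded_mod" where
  "koszul k = \<lparr>mcarrier = chains k, msmult = (\<lambda>a u. single 0 a * u), mcomponent = chain_component k\<rparr>"

text \<open>When all q_us are 1, this is the classical sign given by the number of elements of S
  below s.\<close>

definition koszul_sign :: "nat \<Rightarrow> nat set \<Rightarrow> 'k" where
  "koszul_sign s S = (\<Prod>u\<in>S \<inter> {..<s}. - inverse (q u s))"

text \<open>The boundary sorted by target: the coefficient of e_T collects the faces obtained from T
  by adding one index.\<close>

definition koszul_diff :: "(nat \<Rightarrow>\<^sub>0 'a) \<Rightarrow> nat \<Rightarrow>\<^sub>0 'a" where
  "koszul_diff u = tuple (\<lambda>T. \<Sum>s\<in>{1..n} - T.
     lookup u (set_encode (insert s T)) * x s * \<iota> (koszul_sign s T))"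

section \<open>Chains and their coordinates\<close>

lemma finite_subset_gens: "S \<subseteq> {1..n} \<Longrightarrow> finite S"
  using finite_subset by blast

lemma set_encode_inject: "S \<subseteq> {1..n} \<Longrightarrow> T \<subseteq> {1..n} \<Longrightarrow> set_encode S = set_encode T \<longleftrightarrow> S = T"
  by (simp add: set_encode_eq finite_subset_gens)

lemma lookup_tuple: "S \<subseteq> {1..n} \<Longrightarrow> lookup (tuple g) (set_encode S) = g S"
proof -
  assume S: "S \<subseteq> {1..n}"
  have "lookup (tuple g) (set_encode S) = (\<Sum>T\<in>Pow {1..n}. if T = S then g S else 0)"
    unfolding tuple_def lookup_sum
    by (intro sum.cong) (use S in \<open>auto simp: lookup_single when_def set_encode_inject\<close>)
  with S show ?thesis by simp
qed

lemma lookup_tuple_outside: "t \<notin> set_encode ` Pow {1..n} \<Longrightarrow> lookup (tuple g) t = 0"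
  unfolding tuple_def lookup_sum by (intro sum.neutral) (auto simp: lookup_single when_def)

lemma tuple_mem_chains:
  assumes "\<And>S. S \<subseteq> {1..n} \<Longrightarrow> card S \<noteq> k \<Longrightarrow> g S = 0"
  shows "tuple g \<in> chains k"
proof -
  have "t \<in> set_encode ` faces k" if "t \<in> keys (tuple g)" for t
  proof -
    have "t \<in> set_encode ` Pow {1..n}"
      using that lookup_tuple_outside[of t g] by (auto simp: in_keys_iff)
    then obtain S where "S \<subseteq> {1..n}" "t = set_encode S" by auto
    then show ?thesis
      using that assms[of S] lookup_tuple[of S g] by (auto simp: in_keys_iff faces_def)
  qed
  then show ?thesis by (auto simp: chains_def)
qed

lemma lookup_chain: "u \<in> chains k \<Longrightarrow> t \<notin> set_encode ` faces k \<Longrightarrow> lookup u t = 0"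
  by (auto simp: chains_def in_keys_iff)

lemma lookup_chain_card:
  "u \<in> chains k \<Longrightarrow> S \<subseteq> {1..n} \<Longrightarrow> card S \<noteq> k \<Longrightarrow> lookup u (set_encode S) = 0"
  by (rule lookup_chain) (auto simp: faces_def set_encode_inject)

lemma coef_add: "coef (u + v) t \<gamma> = coef u t \<gamma> + coef v t \<gamma>"
  by (simp add: coef_def lookup_add coords_add)

lemma coef_diff: "coef (u - v) t \<gamma> = coef u t \<gamma> - coef v t \<gamma>"
  by (simp add: coef_def lookup_minus coords_diff)

lemma coef_zero [simp]: "coef 0 t \<gamma> = 0"
  by (simp add: coef_def)

lemma coef_sum: "coef (sum F A) t \<gamma> = (\<Sum>a\<in>A. coef (F a) t \<gamma>)"
  by (simp add: coef_def lookup_sum coords_sum)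

lemma coef_outside: "\<gamma> \<notin> exponents n \<Longrightarrow> coef u t \<gamma> = 0"
  using keys_coords[of "lookup u t"] by (auto simp: coef_def in_keys_iff)

lemma coef_eqI: "(\<And>t \<gamma>. coef u t \<gamma> = coef v t \<gamma>) \<Longrightarrow> u = v"
  unfolding coef_def by (metis poly_mapping_eqI coords_inject)

lemma chain_eqI:
  assumes "u \<in> chains k" "v \<in> chains k"
    and "\<And>S \<gamma>. S \<subseteq> {1..n} \<Longrightarrow> \<gamma> \<in> exponents n \<Longrightarrow> coef u (set_encode S) \<gamma> = coef v (set_encode S) \<gamma>"
  shows "u = v"
proof (rule coef_eqI)
  fix t \<gamma>
  show "coef u t \<gamma> = coef v t \<gamma>"
  proof (cases "t \<in> set_encode ` faces k \<and> \<gamma> \<in> exponents n")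
    case True
    then show ?thesis using assms(3) by (auto simp: faces_def)
  next
    case False
    then show ?thesis
      using lookup_chain[OF assms(1), of t] lookup_chain[OF assms(2), of t]
      by (auto simp: coef_outside) (auto simp: coef_def)
  qed
qed

section \<open>The graded free modules of the complex\<close>

lemma zero_mem_chains: "0 \<in> chains k"
  by (simp add: chains_def)

lemma diff_mem_chains: "u \<in> chains k \<Longrightarrow> v \<in> chains k \<Longrightarrow> u - v \<in> chains k"
  using keys_diff[of u v] by (auto simp: chains_def)

lemma smult_mem_chains: "u \<in> chains k \<Longrightarrow> single 0 a * u \<in> chains k"
  by (auto simp: chains_def in_keys_iff lookup_single_0_mult subset_iff dest!: mult_not_zero)

lemma sum_chain_components:
  assumes u: "u \<in> chains k"
  shows "\<exists>!c :: nat \<Rightarrow>\<^sub>0 (nat \<Rightarrow>\<^sub>0 'a). (\<forall>j. lookup c j \<in> chain_component k j) \<and> u = (\<Sum>j\<in>keys c. lookup c j)"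
proof (rule ex_ex1I)
  \<comment> \<open>The part of a ring element that has degree j once multiplied by a symbol of
    degree k. The condition is a sum because j - k would truncate.\<close>
  define restr where "restr j a = (\<Sum>\<gamma>\<in>keys (coords a).
    \<iota> (lookup (coords a) \<gamma> when exp_sum n \<gamma> + k = j) * std_monomial n x \<gamma>)" for j a
  have "coords (restr j a) = (\<Sum>\<gamma>\<in>keys (coords a). single \<gamma> (lookup (coords a) \<gamma> when exp_sum n \<gamma> + k = j))"
    for j a
    unfolding restr_def coords_sum
    by (intro sum.cong refl coords_monomial) (use keys_coords in blast)
  then have coords_restr: "lookup (coords (restr j a)) \<gamma> = (lookup (coords a) \<gamma> when exp_sum n \<gamma> + k = j)"
    for j a \<gamma>
    by (simp add: lookup_sum lookup_single when_def in_keys_iff)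
  define part where "part j = (\<Sum>t\<in>keys u. single t (restr j (lookup u t)))" for j
  have lookup_part: "lookup (part j) t = restr j (lookup u t)" for j t
    unfolding part_def by (rule lookup_sum_single_keys) (simp add: restr_def)
  have coef_part: "coef (part j) t \<gamma> = (coef u t \<gamma> when exp_sum n \<gamma> + k = j)" for j t \<gamma>
    by (simp add: coef_def lookup_part coords_restr)
  have "part j \<in> chains k" for j
  proof -
    have "keys (part j) \<subseteq> keys u"
      using lookup_part[of j] by (auto simp: in_keys_iff restr_def)
    then show ?thesis using u by (auto simp: chains_def)
  qed
  then have part_mem: "part j \<in> chain_component k j" for j
    by (auto simp: chain_component_def coef_part when_def)
  \<comment> \<open>The finitely many degrees that occur in \<open>u\<close>; they give the
    decomposition finite support.\<close>
  define J where "J = (\<Union>t\<in>keys u. (\<lambda>\<gamma>. exp_sum n \<gamma> + k) ` keys (coords (lookup u t)))"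
  have "finite J" by (simp add: J_def)
  have in_J: "exp_sum n \<gamma> + k \<in> J" if "coef u t \<gamma> \<noteq> 0" for t \<gamma>
    using that by (force simp: J_def coef_def in_keys_iff)
  define c where "c = (\<Sum>j\<in>J. single j (part j))"
  have lookup_c: "lookup c j = (part j when j \<in> J)" for j
    using \<open>finite J\<close> by (simp add: c_def lookup_sum lookup_single when_def)
  have "(\<Sum>j\<in>keys c. lookup c j) = (\<Sum>j\<in>J. part j)"
    using \<open>finite J\<close> by (intro sum.mono_neutral_cong_left) (auto simp: lookup_c in_keys_iff)
  moreover have "(\<Sum>j\<in>J. part j) = u"
  proof (rule coef_eqI)
    fix t \<gamma>
    show "coef (\<Sum>j\<in>J. part j) t \<gamma> = coef u t \<gamma>"
      using \<open>finite J\<close> in_J[of t \<gamma>] by (auto simp: coef_sum coef_part when_def)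
  qed
  moreover have "0 \<in> chain_component k j" for j
    by (simp add: chain_component_def zero_mem_chains)
  ultimately show "\<exists>c. (\<forall>j. lookup c j \<in> chain_component k j) \<and> u = (\<Sum>j\<in>keys c. lookup c j)"
    using part_mem by (intro exI[of _ c]) (auto simp: lookup_c when_def)
next
  \<comment> \<open>Uniqueness: each coordinate of \<open>u\<close> belongs to exactly one degree,
    so it determines that coordinate in the components of any decomposition.\<close>
  have coef_lookup: "coef (lookup c j) t \<gamma> = (coef u t \<gamma> when exp_sum n \<gamma> + k = j)"
    if c: "\<forall>j. lookup c j \<in> chain_component k j" "u = (\<Sum>j\<in>keys c. lookup c j)"
    for c :: "nat \<Rightarrow>\<^sub>0 (nat \<Rightarrow>\<^sub>0 'a)" and j t \<gamma>
  proof (cases "exp_sum n \<gamma> + k = j")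
    case True
    have "coef u t \<gamma> = (\<Sum>i\<in>keys c. coef (lookup c i) t \<gamma>)"
      by (subst c(2)) (rule coef_sum)
    also have "\<dots> = (\<Sum>i\<in>keys c. if i = j then coef (lookup c j) t \<gamma> else 0)"
      using c(1) True by (intro sum.cong) (auto simp: chain_component_def)
    finally show ?thesis using True by (simp add: in_keys_iff split: if_splits)
  next
    case False
    then show ?thesis using c(1) by (auto simp: chain_component_def)
  qed
  fix c d :: "nat \<Rightarrow>\<^sub>0 (nat \<Rightarrow>\<^sub>0 'a)"
  assume "(\<forall>j. lookup c j \<in> chain_component k j) \<and> u = (\<Sum>j\<in>keys c. lookup c j)"
    and "(\<forall>j. lookup d j \<in> chain_component k j) \<and> u = (\<Sum>j\<in>keys d. lookup d j)"
  then show "c = d"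
    using coef_lookup[of c] coef_lookup[of d]
    by (intro poly_mapping_eqI coef_eqI) metis
qed

lemma smult_mem_component:
  assumes a: "a \<in> alg_component \<iota> n x i" and u: "u \<in> chain_component k j"
  shows "single 0 a * u \<in> chain_component k (i + j)"
proof -
  have "exp_sum n \<gamma> + k = i + j" if "coef (single 0 a * u) t \<gamma> \<noteq> 0" for t \<gamma>
  proof -
    have *: "\<gamma> \<in> keys (coords (a * lookup u t))"
      using that by (simp add: coef_def lookup_single_0_mult in_keys_iff)
    \<comment> \<open>A nonzero entry of \<open>u\<close> is needed to know k \<le> j; only then is
      the difference j - k below the true degree of that entry.\<close>
    then have "lookup u t \<noteq> 0" by auto
    then obtain \<delta> where "\<delta> \<in> keys (coords (lookup u t))"
      by (metis coords_inject coords_zero ex_in_conv keys_eq_empty)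
    then have "exp_sum n \<delta> + k = j"
      using u by (auto simp: chain_component_def coef_def in_keys_iff)
    then have "k \<le> j" by simp
    have "lookup u t \<in> alg_component \<iota> n x (j - k)"
      using u by (fastforce simp: alg_component_iff chain_component_def coef_def in_keys_iff)
    from alg_component_mult[OF a this] * have "exp_sum n \<gamma> = i + (j - k)"
      by (simp add: alg_component_iff)
    with \<open>k \<le> j\<close> show ?thesis by simp
  qed
  then show ?thesis
    using u by (auto simp: chain_component_def smult_mem_chains)
qed

lemma is_graded_module_koszul: "is_graded_module (alg_component \<iota> n x) (koszul k)"
proof -
  have "u - v \<in> chain_component k j" if "u \<in> chain_component k j" "v \<in> chain_component k j" for u v j
  proof -
    have "exp_sum n \<gamma> + k = j" if "coef (u - v) t \<gamma> \<noteq> 0" for t \<gamma>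
    proof -
      from that have "coef u t \<gamma> \<noteq> 0 \<or> coef v t \<gamma> \<noteq> 0"
        by (auto simp: coef_diff)
      then show ?thesis
        using \<open>u \<in> _\<close> \<open>v \<in> _\<close> unfolding chain_component_def by blast
    qed
    then show ?thesis
      using that by (simp add: chain_component_def diff_mem_chains)
  qed
  moreover have "0 \<in> chain_component k j" for j
    by (simp add: chain_component_def zero_mem_chains)
  ultimately have "add_subgroup (chain_component k j)" for j
    unfolding add_subgroup_def by blast
  moreover have "chain_component k j \<subseteq> chains k" for j
    by (auto simp: chain_component_def)
  ultimately have "is_direct_sum (chains k) (chain_component k)"
    unfolding is_direct_sum_def by (intro conjI allI ballI sum_chain_components)
  moreover have "single 0 (a * b) * u = single 0 a * (single 0 b * u)" for a b and u :: "nat \<Rightarrow>\<^sub>0 'a"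
    by (simp add: mult_single flip: mult.assoc)
  ultimately show ?thesis
    unfolding is_graded_module_def koszul_def
    by (auto simp: add_subgroup_def zero_mem_chains diff_mem_chains smult_mem_chains
        smult_mem_component distrib_left distrib_right single_add)
qed

lemma free_koszul: "free_generated_in_degree k (koszul k)"
proof -
  let ?E = "(\<lambda>t. single t 1) ` set_encode ` faces k"
  have "coords 1 = single 0 1"
    using coords_iota[of 1] by simp
  then have "?E \<subseteq> chain_component k k"
    by (auto simp: chain_component_def chains_def coef_def lookup_single lookup_one when_def split: if_splits)
  moreover have "is_basis (\<lambda>a u. single 0 a * u) (chains k) ?E (\<lambda>e. e)"
    unfolding chains_def by (rule is_basis_single)
  ultimately show ?thesis
    unfolding free_generated_in_degree_def koszul_def by auto
qed

section \<open>Signs and the differential\<close>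

lemma koszul_sign_nonzero: "s \<in> {1..n} \<Longrightarrow> S \<subseteq> {1..n} \<Longrightarrow> koszul_sign s S \<noteq> 0"
  using q_nonzero by (auto simp: koszul_sign_def finite_subset_gens)

lemma koszul_sign_insert_ge: "s \<le> t \<Longrightarrow> koszul_sign s (insert t S) = koszul_sign s S"
  unfolding koszul_sign_def by (intro prod.cong) auto

lemma koszul_sign_insert_less:
  "t < s \<Longrightarrow> t \<notin> S \<Longrightarrow> koszul_sign s (insert t S) = - inverse (q t s) * koszul_sign s S"
  by (simp add: koszul_sign_def)

lemma lookup_koszul_diff:
  "T \<subseteq> {1..n} \<Longrightarrow> lookup (koszul_diff u) (set_encode T) =
     (\<Sum>s\<in>{1..n} - T. lookup u (set_encode (insert s T)) * x s * \<iota> (koszul_sign s T))"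
  by (simp only: koszul_diff_def lookup_tuple)

text \<open>Term \<open>s\<close> reads a coordinate with one x_s fewer and with \<open>s\<close>
  added to the face. The multidegree is therefore unchanged, which makes exactness a question about
  scalars in each multidegree.\<close>

lemma coef_koszul_diff:
  assumes "T \<subseteq> {1..n}"
  shows "coef (koszul_diff u) (set_encode T) \<gamma> = (\<Sum>s\<in>{1..n} - T. if lookup \<gamma> s = 0 then 0
     else koszul_sign s T * reorder_coeff n q s \<gamma> * coef u (set_encode (insert s T)) (\<gamma> - single s 1))"
  unfolding coef_def lookup_koszul_diff[OF assms] coords_sum lookup_sum
  by (intro sum.cong) (auto simp: coords_scale coords_mult_gen simp flip: iota_central)

lemma koszul_diff_eqI:
  assumes "\<And>T. T \<subseteq> {1..n} \<Longrightarrow> lookup (koszul_diff u) (set_encode T) = lookup w (set_encode T)"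
    and "\<And>t. t \<notin> set_encode ` Pow {1..n} \<Longrightarrow> lookup w t = 0"
  shows "koszul_diff u = w"
proof (rule poly_mapping_eqI)
  fix t
  show "lookup (koszul_diff u) t = lookup w t"
    using assms lookup_tuple_outside[of t]
    by (cases "t \<in> set_encode ` Pow {1..n}") (auto simp: koszul_diff_def)
qed

lemma koszul_diff_mem_chains: "u \<in> chains (Suc k) \<Longrightarrow> koszul_diff u \<in> chains k"
  unfolding koszul_diff_def
proof (rule tuple_mem_chains, rule sum.neutral, rule ballI)
  fix S s assume "u \<in> chains (Suc k)" "S \<subseteq> {1..n}" "card S \<noteq> k" "s \<in> {1..n} - S"
  then have "lookup u (set_encode (insert s S)) = 0"
    by (intro lookup_chain_card[of u "Suc k"]) (auto simp: finite_subset_gens)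
  then show "lookup u (set_encode (insert s S)) * x s * \<iota> (koszul_sign s S) = 0"
    by simp
qed

text \<open>Makes the cycle condition automatic at the end of the complex, where the augmentation
  takes its place.\<close>

lemma koszul_diff_chains_0: "u \<in> chains 0 \<Longrightarrow> koszul_diff u = 0"
proof (rule koszul_diff_eqI)
  fix T assume u: "u \<in> chains 0" and T: "T \<subseteq> {1..n}"
  have "lookup u (set_encode (insert s T)) = 0" if "s \<in> {1..n} - T" for s
    using u T that by (intro lookup_chain_card[of u 0]) (auto simp: finite_subset_gens)
  then show "lookup (koszul_diff u) (set_encode T) = lookup 0 (set_encode T)"
    by (simp add: lookup_koszul_diff[OF T])
qed simp

lemma koszul_diff_add: "koszul_diff (u + v) = koszul_diff u + koszul_diff v"
proof (rule koszul_diff_eqI)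
  fix T assume "T \<subseteq> {1..n}"
  then show "lookup (koszul_diff (u + v)) (set_encode T) = lookup (koszul_diff u + koszul_diff v) (set_encode T)"
    by (simp add: lookup_koszul_diff lookup_add sum.distrib distrib_right)
qed (auto simp: lookup_add koszul_diff_def lookup_tuple_outside)

lemma koszul_diff_smult: "koszul_diff (single 0 a * u) = single 0 a * koszul_diff u"
proof (rule koszul_diff_eqI)
  fix T assume "T \<subseteq> {1..n}"
  then show "lookup (koszul_diff (single 0 a * u)) (set_encode T)
      = lookup (single 0 a * koszul_diff u) (set_encode T)"
    by (simp add: lookup_koszul_diff lookup_single_0_mult sum_distrib_left mult.assoc)
qed (auto simp: lookup_single_0_mult koszul_diff_def lookup_tuple_outside)

lemma koszul_diff_mem_component:
  assumes u: "u \<in> chain_component (Suc k) j"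
  shows "koszul_diff u \<in> chain_component k j"
proof -
  have "exp_sum n \<gamma> + k = j" if nz: "coef (koszul_diff u) t \<gamma> \<noteq> 0" for t \<gamma>
  proof -
    have "t \<in> set_encode ` Pow {1..n}"
    proof (rule ccontr)
      assume "t \<notin> set_encode ` Pow {1..n}"
      then have "lookup (koszul_diff u) t = 0"
        unfolding koszul_diff_def by (rule lookup_tuple_outside)
      with nz show False by (simp add: coef_def)
    qed
    then obtain T where T: "T \<subseteq> {1..n}" "t = set_encode T" by auto
    have "(\<Sum>s\<in>{1..n} - T. if lookup \<gamma> s = 0 then 0 else koszul_sign s T
        * reorder_coeff n q s \<gamma> * coef u (set_encode (insert s T)) (\<gamma> - single s 1)) \<noteq> 0"
      using nz unfolding T(2) coef_koszul_diff[OF T(1)] .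
    then obtain s where "s \<in> {1..n} - T" "(if lookup \<gamma> s = 0 then 0 else koszul_sign s T
        * reorder_coeff n q s \<gamma> * coef u (set_encode (insert s T)) (\<gamma> - single s 1)) \<noteq> 0"
      by (rule sum.not_neutral_contains_not_neutral)
    then have s: "s \<in> {1..n}" "lookup \<gamma> s \<noteq> 0"
      and "coef u (set_encode (insert s T)) (\<gamma> - single s 1) \<noteq> 0"
      by (auto split: if_splits)
    then have "exp_sum n (\<gamma> - single s 1) + Suc k = j"
      using u by (auto simp: chain_component_def)
    moreover have "\<gamma> = (\<gamma> - single s 1) + single s 1"
      using s(2) by (intro poly_mapping_eqI) (auto simp: lookup_add lookup_minus lookup_single when_def)
    then have "exp_sum n \<gamma> = exp_sum n (\<gamma> - single s 1) + 1"
      using exp_sum_add[of n "\<gamma> - single s 1" "single s 1"] exp_sum_single[OF s(1), of 1] by simp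
    ultimately show ?thesis by simp
  qed
  then show ?thesis
    using u by (auto simp: chain_component_def koszul_diff_mem_chains)
qed

text \<open>For s < t the two orders of removal differ by a factor -1/q_st, since s counts in the
  sign of t but not conversely, and by the factor q_st from swapping the generators. The product of
  these is -1.\<close>

lemma koszul_diff_diff: "koszul_diff (koszul_diff u) = 0"
proof (rule koszul_diff_eqI)
  fix T assume T: "T \<subseteq> {1..n}"
  define F where "F s t = lookup u (set_encode (insert s (insert t T))) * x s
    * \<iota> (koszul_sign s (insert t T)) * x t * \<iota> (koszul_sign t T)" for s t
  have "lookup (koszul_diff (koszul_diff u)) (set_encode T) = (\<Sum>t\<in>{1..n} - T. \<Sum>s\<in>({1..n} - T) - {t}. F s t)"
    unfolding lookup_koszul_diff[OF T] F_def
  proof (rule sum.cong[OF refl])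
    fix t assume "t \<in> {1..n} - T"
    then have "insert t T \<subseteq> {1..n}" using T by auto
    moreover have "{1..n} - T - {t} = {1..n} - insert t T" by auto
    ultimately show "lookup (koszul_diff u) (set_encode (insert t T)) * x t * \<iota> (koszul_sign t T)
        = (\<Sum>s\<in>{1..n} - T - {t}. lookup u (set_encode (insert s (insert t T))) * x s
          * \<iota> (koszul_sign s (insert t T)) * x t * \<iota> (koszul_sign t T))"
      by (simp only: lookup_koszul_diff sum_distrib_right)
  qed
  also have "\<dots> = 0"
  proof (rule sum_antisymmetric)
    fix s t assume "s \<in> {1..n} - T" "t \<in> {1..n} - T" "s < t"
    then have st: "1 \<le> s" "s < t" "t \<le> n" "s \<notin> T" by auto
    define b where "b = lookup u (set_encode (insert s (insert t T)))"
    define c where "c = koszul_sign s T * koszul_sign t T"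
    \<comment> \<open>Gathers the central scalars in front, leaving only the order of the two
      generators to compare.\<close>
    have move: "b * y * \<iota> r * z * \<iota> r' = \<iota> (r * r') * (b * (y * z))" for y z r r'
    proof -
      have "b * y * \<iota> r * z * \<iota> r' = \<iota> r' * (\<iota> r * (b * y) * z)"
        by (simp only: iota_central[symmetric])
      also have "\<dots> = \<iota> (r' * r) * (b * (y * z))"
        by (simp only: iota_mult mult.assoc)
      finally show ?thesis by (simp only: mult.commute[of r r'])
    qed
    have Fst: "F s t = \<iota> c * (b * (x s * x t))"
      unfolding F_def b_def[symmetric] move c_def
      by (simp only: koszul_sign_insert_ge[OF less_imp_le[OF \<open>s < t\<close>]])
    have "F t s = \<iota> (- inverse (q s t) * c) * (b * (x t * x s))"
      unfolding F_def insert_commute[of t s] b_def[symmetric] move c_def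
      by (simp only: koszul_sign_insert_less[OF \<open>s < t\<close> \<open>s \<notin> T\<close>]) (simp add: ac_simps)
    moreover have "b * (x t * x s) = \<iota> (q s t) * (b * (x s * x t))"
      using gen_swap[OF st(1-3)] by (simp add: mult.assoc iota_left_commute)
    ultimately have "F t s = \<iota> ((- inverse (q s t) * c) * q s t) * (b * (x s * x t))"
      by (simp only: iota_mult mult.assoc)
    also have "(- inverse (q s t) * c) * q s t = - c"
      using q_nonzero[OF st(1-3)] by simp
    finally show "F s t + F t s = 0"
      using Fst by (simp add: iota_uminus)
  qed simp
  finally show "lookup (koszul_diff (koszul_diff u)) (set_encode T) = lookup 0 (set_encode T)"
    by simp
qed simp

section \<open>Exactness\<close>

lemma reorder_coeff_above:
  assumes "\<And>t. s < t \<Longrightarrow> t \<le> n \<Longrightarrow> lookup \<gamma> t = 0"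
  shows "reorder_coeff n q s \<gamma> = 1"
  unfolding reorder_coeff_def using assms by (intro prod.neutral) auto

lemma reorder_coeff_add_single:
  assumes "s < t" "t \<le> n"
  shows "reorder_coeff n q s (\<gamma> + single t 1) = q s t * reorder_coeff n q s \<gamma>"
proof -
  have "reorder_coeff n q s (\<gamma> + single t 1)
      = (\<Prod>u\<in>{s<..n}. (if u = t then q s t else 1) * q s u ^ lookup \<gamma> u)"
    unfolding reorder_coeff_def
    by (intro prod.cong) (auto simp: lookup_add lookup_single when_def)
  then show ?thesis
    using assms by (simp add: prod.distrib reorder_coeff_def)
qed

text \<open>Lets the contracting homotopy be given by a case distinction on scalars, with no formula
  in the ring.\<close>

lemma ex_chain_coef:
  fixes V :: "nat set \<Rightarrow> (nat \<Rightarrow>\<^sub>0 nat) \<Rightarrow> 'k"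
  assumes fin: "\<And>S. S \<subseteq> {1..n} \<Longrightarrow> finite {\<gamma>. V S \<gamma> \<noteq> 0}"
    and exps: "\<And>S \<gamma>. V S \<gamma> \<noteq> 0 \<Longrightarrow> \<gamma> \<in> exponents n"
    and card: "\<And>S \<gamma>. S \<subseteq> {1..n} \<Longrightarrow> V S \<gamma> \<noteq> 0 \<Longrightarrow> card S = k"
  shows "\<exists>v\<in>chains k. \<forall>S\<subseteq>{1..n}. \<forall>\<gamma>. coef v (set_encode S) \<gamma> = V S \<gamma>"
proof
  let ?v = "tuple (\<lambda>S. combo (Abs_poly_mapping (V S)))"
  show "?v \<in> chains k"
  proof (rule tuple_mem_chains)
    fix S assume "S \<subseteq> {1..n}" "card S \<noteq> k"
    then have "V S = (\<lambda>_. 0)" using card by blast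
    then show "combo (Abs_poly_mapping (V S)) = 0" by simp
  qed
  show "\<forall>S\<subseteq>{1..n}. \<forall>\<gamma>. coef ?v (set_encode S) \<gamma> = V S \<gamma>"
  proof (intro allI impI)
    fix S \<gamma> assume S: "S \<subseteq> {1..n}"
    have lookup: "lookup (Abs_poly_mapping (V S)) = V S"
      using fin[OF S] by simp
    then have "keys (Abs_poly_mapping (V S)) \<subseteq> exponents n"
      using exps by (auto simp: in_keys_iff)
    then show "coef ?v (set_encode S) \<gamma> = V S \<gamma>"
      by (simp add: coef_def lookup_tuple[OF S] coords_combo lookup)
  qed
qed

text \<open>
  \<open>V\<close> below gives the coordinates of the contracting homotopy applied to \<open>u\<close>. Since \<open>x\<^sub>m\<close> is the
  last letter of the standard monomial, moving it costs no reordering coefficient.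
\<close>

lemma koszul_exact:
  assumes u: "u \<in> chains k" and du: "koszul_diff u = 0" and u0: "coef u 0 0 = 0"
  shows "\<exists>v\<in>chains (Suc k). koszul_diff v = u"
proof -
  note [simp del] = One_nat_def
  \<comment> \<open>The largest variable in the multidegree of x^\<gamma> e_T. \<open>Max\<close> of
    the empty set is unspecified, which is why \<open>V\<close> excludes the zero
    multidegree.\<close>
  define M where "M T \<gamma> = Max (T \<union> keys \<gamma>)" for T :: "nat set" and \<gamma> :: "nat \<Rightarrow>\<^sub>0 nat"
  define V where "V T \<gamma> = (if T \<subseteq> {1..n} \<and> \<gamma> \<in> exponents n \<and> T \<union> keys \<gamma> \<noteq> {} \<and> M T \<gamma> \<in> T
      then coef u (set_encode (T - {M T \<gamma>})) (\<gamma> + single (M T \<gamma>) 1)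
             * inverse (koszul_sign (M T \<gamma>) (T - {M T \<gamma>}))
      else 0)" for T \<gamma>
  have V_nz: "\<gamma> \<in> exponents n \<and> M T \<gamma> \<in> T
      \<and> coef u (set_encode (T - {M T \<gamma>})) (\<gamma> + single (M T \<gamma>) 1) \<noteq> 0"
    if "V T \<gamma> \<noteq> 0" for T \<gamma>
    using that by (auto simp: V_def split: if_splits)
  have "\<exists>v\<in>chains (Suc k). \<forall>S\<subseteq>{1..n}. \<forall>\<gamma>. coef v (set_encode S) \<gamma> = V S \<gamma>"
  proof (rule ex_chain_coef)
    fix S assume S: "S \<subseteq> {1..n}"
    let ?K = "\<Union>R\<in>Pow {1..n}. keys (coords (lookup u (set_encode R)))"
    \<comment> \<open>Each such exponent arises from one of the finitely many exponents of
      \<open>u\<close> by removing one variable.\<close>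
    have "{\<gamma>. V S \<gamma> \<noteq> 0} \<subseteq> (\<lambda>(m, \<delta>). \<delta> - single m 1) ` ({1..n} \<times> ?K)"
    proof
      fix \<gamma> assume "\<gamma> \<in> {\<gamma>. V S \<gamma> \<noteq> 0}"
      then have nz: "M S \<gamma> \<in> S" "coef u (set_encode (S - {M S \<gamma>})) (\<gamma> + single (M S \<gamma>) 1) \<noteq> 0"
        using V_nz[of S \<gamma>] by auto
      have "\<gamma> + single (M S \<gamma>) 1 \<in> ?K"
        using nz(2) S by (intro UN_I[of "S - {M S \<gamma>}"]) (auto simp: coef_def in_keys_iff)
      then show "\<gamma> \<in> (\<lambda>(m, \<delta>). \<delta> - single m 1) ` ({1..n} \<times> ?K)"
        using nz(1) S by (intro image_eqI[of _ _ "(M S \<gamma>, \<gamma> + single (M S \<gamma>) 1)"]) auto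
    qed
    then show "finite {\<gamma>. V S \<gamma> \<noteq> 0}"
      by (rule finite_subset) auto
  next
    fix S \<gamma> assume "V S \<gamma> \<noteq> 0"
    then show "\<gamma> \<in> exponents n" using V_nz by blast
  next
    fix S \<gamma> assume S: "S \<subseteq> {1..n}" and "V S \<gamma> \<noteq> 0"
    then have m: "M S \<gamma> \<in> S" and nz: "lookup u (set_encode (S - {M S \<gamma>})) \<noteq> 0"
      using V_nz[of S \<gamma>] by (auto simp: coef_def)
    have "S - {M S \<gamma>} \<subseteq> {1..n}" using S by auto
    with nz have "card (S - {M S \<gamma>}) = k"
      using lookup_chain_card[OF u] by blast
    then show "card S = Suc k"
      using card_Suc_Diff1[OF finite_subset_gens[OF S] m] by simp
  qed
  then obtain v where v: "v \<in> chains (Suc k)"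
    and "\<forall>S\<subseteq>{1..n}. \<forall>\<gamma>. coef v (set_encode S) \<gamma> = V S \<gamma>"
    by (rule bexE)
  then have coef_v: "coef v (set_encode S) \<gamma> = V S \<gamma>" if "S \<subseteq> {1..n}" for S \<gamma>
    using that by simp
  have "koszul_diff v = u"
  proof (rule chain_eqI[OF koszul_diff_mem_chains[OF v] u])
    fix T \<gamma> assume T: "T \<subseteq> {1..n}" and \<gamma>: "\<gamma> \<in> exponents n"
    define m where "m = M T \<gamma>"
    define G where "G s = (if lookup \<gamma> s = 0 then 0 else
      koszul_sign s T * reorder_coeff n q s \<gamma> * V (insert s T) (\<gamma> - single s 1))" for s
    have dv: "coef (koszul_diff v) (set_encode T) \<gamma> = (\<Sum>s\<in>{1..n} - T. G s)"
      unfolding coef_koszul_diff[OF T] G_def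
      by (intro sum.cong) (use T in \<open>auto simp: coef_v\<close>)
    have fin: "finite (T \<union> keys \<gamma>)" using T by (simp add: finite_subset_gens)
    have le_m: "s \<le> m" if "s \<in> T \<union> keys \<gamma>" for s
      using that fin by (auto simp: m_def M_def)
    have above_m: "lookup \<gamma> t = 0" if "m < t" for t
      using le_m[of t] that by (auto simp: in_keys_iff)
    \<comment> \<open>Moving \<open>s\<close> from the exponent to the face leaves the set of
      variables present unchanged, so the same \<open>m\<close> governs every term of the
      differential.\<close>
    have shifted: "insert s T \<union> keys (\<gamma> - single s 1) = T \<union> keys \<gamma>"
      "\<gamma> - single s 1 \<in> exponents n" if "lookup \<gamma> s \<noteq> 0" for s
      using that \<gamma> by (auto simp: exponents_def in_keys_iff lookup_minus lookup_single when_def subset_iff)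
    have V_shifted: "V (insert s T) (\<gamma> - single s 1) = (if m \<in> insert s T
        then coef u (set_encode (insert s T - {m})) (\<gamma> - single s 1 + single m 1)
               * inverse (koszul_sign m (insert s T - {m}))
        else 0)" if "lookup \<gamma> s \<noteq> 0" "s \<in> {1..n}" for s
    proof -
      have "M (insert s T) (\<gamma> - single s 1) = m"
        unfolding M_def shifted(1)[OF that(1)] m_def ..
      moreover have "insert s T \<subseteq> {1..n}" using T that by auto
      ultimately show ?thesis
        unfolding V_def using shifted(2)[OF that(1)] by simp
    qed
    show "coef (koszul_diff v) (set_encode T) \<gamma> = coef u (set_encode T) \<gamma>"
    \<comment> \<open>In the zero multidegree a boundary has coordinate zero, and \<open>u0\<close>
      says the same of \<open>u\<close>.\<close>
    proof (cases "T \<union> keys \<gamma> = {}")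
      case True
      then have "T = {}" "\<gamma> = 0" by auto
      then show ?thesis
        unfolding dv by (simp add: G_def u0)
    next
      case False
      then have "m \<in> T \<union> keys \<gamma>"
        unfolding m_def M_def by (intro Max_in fin)
      then have m: "m \<in> {1..n}"
        using T \<gamma> by (auto simp: exponents_def)
      show ?thesis
      proof (cases "m \<in> T")
        case m_notin: False
        then have m_key: "lookup \<gamma> m \<noteq> 0"
          using \<open>m \<in> T \<union> keys \<gamma>\<close> by (simp add: in_keys_iff)
        \<comment> \<open>Adding any other index to the face still leaves \<open>m\<close> outside
          it, where \<open>V\<close> vanishes. The surviving term \<open>s = m\<close> undoes the
          homotopy, its sign cancelling the inverse sign in \<open>V\<close>.\<close>
        have "G s = 0" if "s \<in> {1..n} - T" "s \<noteq> m" for s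
          using that m_notin by (auto simp: G_def V_shifted)
        then have "(\<Sum>s\<in>{1..n} - T. G s) = (\<Sum>s\<in>{1..n} - T. if s = m then G m else 0)"
          by (intro sum.cong) auto
        also have "\<dots> = G m" using m m_notin by simp
        also have "\<gamma> - single m 1 + single m 1 = \<gamma>"
          using m_key by (intro poly_mapping_eqI) (auto simp: lookup_add lookup_minus lookup_single when_def)
        then have "G m = koszul_sign m T * coef u (set_encode T) \<gamma> * inverse (koszul_sign m T)"
          using m_key m_notin V_shifted[OF m_key m] reorder_coeff_above[of m \<gamma>] above_m
          by (simp add: G_def)
        also have "\<dots> = coef u (set_encode T) \<gamma>"
          using koszul_sign_nonzero[OF m T] by simp
        finally show ?thesis by (simp only: dv)
      next
        case m_in: True
        \<comment> \<open>The cycle condition is applied at the point of the same multidegree where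
          x_m sits in the exponent. Its term for \<open>m\<close> is the wanted coordinate of
          \<open>u\<close>; the remaining terms must match those of the boundary of
          \<open>v\<close>.\<close>
        define T' where "T' = T - {m}"
        define \<gamma>' where "\<gamma>' = \<gamma> + single m 1"
        have T': "T' \<subseteq> {1..n}" "insert m T' = T" "m \<notin> T'"
          using T m_in by (auto simp: T'_def)
        define F where "F s = (if lookup \<gamma>' s = 0 then 0 else koszul_sign s T'
          * reorder_coeff n q s \<gamma>' * coef u (set_encode (insert s T')) (\<gamma>' - single s 1))" for s
        have sign: "koszul_sign m T' \<noteq> 0"
          by (rule koszul_sign_nonzero[OF m T'(1)])
        have "0 = coef (koszul_diff u) (set_encode T') \<gamma>'"
          by (simp add: du)
        also have "\<dots> = (\<Sum>s\<in>{1..n} - T'. F s)"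
          unfolding coef_koszul_diff[OF T'(1)] F_def ..
        also have "{1..n} - T' = insert m ({1..n} - T)"
          using m T'(2,3) by auto
        also have "(\<Sum>s\<in>\<dots>. F s) = F m + (\<Sum>s\<in>{1..n} - T. F s)"
          using m_in by simp
        also have "F m = koszul_sign m T' * coef u (set_encode T) \<gamma>"
          using reorder_coeff_above[of m \<gamma>'] above_m T'(2)
          by (simp add: F_def \<gamma>'_def lookup_add lookup_single)
        finally have cycle: "koszul_sign m T' * coef u (set_encode T) \<gamma> = - (\<Sum>s\<in>{1..n} - T. F s)"
          by (simp add: eq_neg_iff_add_eq_0)
        \<comment> \<open>In \<open>F s\<close> the generator x_s passes one more x_m, costing
          \<open>q s m\<close>; in \<open>G s\<close> the index \<open>s\<close> enters the sign of
          \<open>m\<close>, contributing \<open>- inverse (q s m)\<close> inside an inverse. The two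
          agree up to the sign -1.\<close>
        have "koszul_sign m T' * G s = - F s" if s: "s \<in> {1..n} - T" for s
        proof (cases "lookup \<gamma> s = 0")
          case True
          then show ?thesis
            using s m_in by (auto simp: G_def F_def \<gamma>'_def lookup_add lookup_single when_def)
        next
          case False
          have "s \<noteq> m" using s m_in by auto
          moreover have "s \<le> m" using le_m[of s] False by (auto simp: in_keys_iff)
          ultimately have "s < m" by simp
          have "s \<notin> T'" using s by (auto simp: T'_def)
          have q: "q s m \<noteq> 0" using q_nonzero[of s m] s \<open>s < m\<close> m by auto
          define w where "w = coef u (set_encode (insert s T')) (\<gamma>' - single s 1)"
          have "insert s T - {m} = insert s T'" using \<open>s \<noteq> m\<close> by (auto simp: T'_def)
          moreover have "\<gamma> - single s 1 + single m 1 = \<gamma>' - single s 1"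
            using \<open>s \<noteq> m\<close> unfolding \<gamma>'_def
            by (intro poly_mapping_eqI) (auto simp: lookup_add lookup_minus lookup_single when_def)
          ultimately have "V (insert s T) (\<gamma> - single s 1)
              = w * inverse (- inverse (q s m) * koszul_sign m T')"
            using V_shifted[OF False] s m_in koszul_sign_insert_less[OF \<open>s < m\<close> \<open>s \<notin> T'\<close>]
            by (simp add: w_def)
          moreover have "koszul_sign s T = koszul_sign s T'"
            using koszul_sign_insert_ge[of s m T'] T'(2) \<open>s < m\<close> by simp
          ultimately have "G s = koszul_sign s T' * reorder_coeff n q s \<gamma> * w
              * inverse (- inverse (q s m) * koszul_sign m T')"
            using False by (simp add: G_def)
          moreover have "F s = koszul_sign s T' * (q s m * reorder_coeff n q s \<gamma>) * w"
            using False reorder_coeff_add_single[OF \<open>s < m\<close>, of \<gamma>] m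
            by (simp add: F_def \<gamma>'_def w_def lookup_add)
          ultimately show ?thesis
            using q sign by (simp add: field_simps)
        qed
        then have "koszul_sign m T' * (\<Sum>s\<in>{1..n} - T. G s) = - (\<Sum>s\<in>{1..n} - T. F s)"
          by (simp add: sum_distrib_left sum_negf)
        with cycle have "koszul_sign m T' * (\<Sum>s\<in>{1..n} - T. G s)
            = koszul_sign m T' * coef u (set_encode T) \<gamma>"
          by simp
        then show ?thesis
          using sign by (simp add: dv)
      qed
    qed
  qed
  with v show ?thesis by blast
qed

section \<open>The resolution and the theorem\<close>

lemma coef_koszul_diff_0: "coef (koszul_diff u) 0 0 = 0"
  using coef_koszul_diff[of "{}" u 0] by simp

lemma coef_chain_Suc: "u \<in> chains (Suc k) \<Longrightarrow> coef u 0 \<gamma> = 0"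
  using lookup_chain_card[of u "Suc k" "{}"] by (simp add: coef_def)

text \<open>In the augmentation the first \<open>0\<close> is the code of the empty face and the
  second is the zero exponent: it takes the constant term of the coefficient of the empty
  symbol.\<close>

lemma koszul_resolution:
  "is_linear_free_resolution (alg_component \<iota> n x) (residue_module \<iota> n x) koszul
     (\<lambda>_. koszul_diff) (\<lambda>u. coef u 0 0)"
proof -
  have "is_graded_hom koszul_diff (koszul (Suc k)) (koszul k)" for k
    by (auto simp: is_graded_hom_def koszul_def koszul_diff_mem_chains koszul_diff_add
        koszul_diff_smult koszul_diff_mem_component)
  \<comment> \<open>Linearity is multiplicativity of the residue map. In components of positive
    degree the constant coordinate vanishes, as the zero exponent has degree 0.\<close>
  moreover have "is_graded_hom (\<lambda>u. coef u 0 0) (koszul 0) (residue_module \<iota> n x)"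
    using residue_map_mult
    by (auto simp: is_graded_hom_def koszul_def residue_module_def coef_add chain_component_def
        residue_map_eq coef_def lookup_single_0_mult lookup_add coords_add)
       (metis exp_sum_zero less_irrefl)
  moreover have "(\<lambda>u. coef u 0 0) ` chains 0 = UNIV"
  proof -
    have "r \<in> (\<lambda>u. coef u 0 0) ` chains 0" for r
    proof (rule image_eqI)
      show "r = coef (single 0 (\<iota> r)) 0 0"
        by (simp add: coef_def coords_iota)
      have "0 \<in> set_encode ` faces 0"
        by (rule image_eqI[of _ _ "{}"]) (auto simp: faces_def)
      then show "single 0 (\<iota> r) \<in> chains 0"
        by (auto simp: chains_def)
    qed
    then show ?thesis by blast
  qed
  moreover have "koszul_diff ` chains (Suc 0) = {u \<in> chains 0. coef u 0 0 = 0}"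
    using koszul_exact[of _ 0] koszul_diff_chains_0 koszul_diff_mem_chains coef_koszul_diff_0
    by (force simp: image_iff)
  moreover have "koszul_diff ` chains (Suc (Suc k)) = {u \<in> chains (Suc k). koszul_diff u = 0}" for k
  proof
    show "koszul_diff ` chains (Suc (Suc k)) \<subseteq> {u \<in> chains (Suc k). koszul_diff u = 0}"
      using koszul_diff_mem_chains koszul_diff_diff by auto
    have "u \<in> koszul_diff ` chains (Suc (Suc k))" if "u \<in> chains (Suc k)" "koszul_diff u = 0" for u
      using koszul_exact[OF that coef_chain_Suc[OF that(1)]] by blast
    then show "{u \<in> chains (Suc k). koszul_diff u = 0} \<subseteq> koszul_diff ` chains (Suc (Suc k))"
      by blast
  qed
  ultimately show ?thesis
    unfolding is_linear_free_resolution_def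
    by (simp add: is_graded_module_koszul free_koszul) (simp add: koszul_def residue_module_def)
qed

lemma Koszul: "homogeneous_Koszul \<iota> n x"
  unfolding homogeneous_Koszul_def using pre_Koszul koszul_resolution by blast

end

theorem corollary3p13:
  fixes \<iota> :: "'k::field \<Rightarrow> 'a::ring_1" and n :: nat and x :: "nat \<Rightarrow> 'a"
  assumes "skew_PBW_extension \<iota> n x"
    and "semi_commutative_ext \<iota> n x"
  shows "homogeneous_Koszul \<iota> n x"
proof -
  \<comment> \<open>The index conditions stand under the existential quantifier, so that choice
    yields a total function \<open>q\<close>.\<close>
  have "\<forall>i j. \<exists>c. i \<in> {1..n} \<longrightarrow> j \<in> {1..n} \<longrightarrow> c \<noteq> 0 \<and> x j * x i = \<iota> c * x i * x j"
    using assms(2) unfolding semi_commutative_ext_def quasi_commutative_ext_def by blast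
  then obtain q where q: "\<And>i j. i \<in> {1..n} \<Longrightarrow> j \<in> {1..n} \<Longrightarrow>
      q i j \<noteq> 0 \<and> x j * x i = \<iota> (q i j) * x i * x j"
    by metis
  interpret quantum_space \<iota> n x q
  proof
    show "ring_embedding \<iota>" "is_basis (\<lambda>r a. \<iota> r * a) UNIV (exponents n) (std_monomial n x)"
      using assms(1) by (simp_all add: skew_PBW_extension_def)
    show "x i * \<iota> r = \<iota> r * x i" if "i \<in> {1..n}" for i r
      using assms(2) that by (auto simp: semi_commutative_ext_def constant_ext_def)
  qed (use q in auto)
  show ?thesis by (rule Koszul)
qed

end
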